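(* Let $(N,\langle\,,\,\rangle)$ be a simply connected $2$-step nilpotent Lie group, where $\langle\,,\,\rangle$ is a left-invariant pseudo-Riemannian metric for which the center is non-degenerate. Let $\mathfrak{n}$ be the Lie algebra of $N$, $\mathfrak{z}$ its center and $\mathfrak{v}=\mathfrak{z}^{\perp}$. Let $\lambda_1,\dots,\lambda_s$ be the different (complex) eigenvalues of the Ricci operator $\mathrm{Rc}$ and $V_{\lambda_i}\subseteq\mathfrak{n}^{\mathbb{C}}$ the subspace associated to $\lambda_i$. Assume that, for some $j$, $$\mathfrak{v}^{\mathbb{C}}=V_{\lambda_1}\oplus\cdots\oplus V_{\lambda_j},\qquad \mathfrak{z}^{\mathbb{C}}=V_{\lambda_{j+1}}\oplus\cdots\oplus V_{\lambda_s}.$$ Then every isometry of $N$ preserves the splitting $TN=\mathfrak{v}N\oplus\mathfrak{z}N$, that is, $$\mathrm{Iso}(N)=\mathrm{Iso}^{spl}(N).$$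
   Context: The center is non-degenerate if the restriction to $\mathfrak{z}$ of the bilinear form $\langle\,,\,\rangle$ induced on $\mathfrak{n}$ is non-degenerate; then $\mathfrak{n}=\mathfrak{v}\oplus\mathfrak{z}$, and left-translation gives left-invariant distributions with $TN=\mathfrak{v}N\oplus\mathfrak{z}N$. $\mathrm{Iso}(N)$ is the full isometry group and $\mathrm{Iso}^{spl}(N)$ is the group of isometries whose differential preserves both $\mathfrak{v}N$ and $\mathfrak{z}N$. For a real vector space $U$, $U^{\mathbb{C}}=U\otimes_{\mathbb{R}}\mathbb{C}$. With $\nabla$ the Levi-Civita connection and $R(u,w)=[\nabla_u,\nabla_w]-\nabla_{[u,w]}$, the Ricci tensor on $\mathfrak{n}$ is $\mathrm{Ric}(u,w)=\mathrm{trace}(\xi\mapsto R(\xi,u)w)$ and the Ricci operator $\mathrm{Rc}:\mathfrak{n}\to\mathfrak{n}$ is defined by $\langle\mathrm{Rc}\,u,w\rangle=\mathrm{Ric}(u,w)$; it is extended $\mathbb{C}$-linearly to $\mathfrak{n}^{\mathbb{C}}$. The subspace associated to $\lambda_i$ is $V_{\lambda_i}=\ker(\mathrm{Rc}-\lambda_i I)^{r_i}$, where $r_i$ is the multiplicity of $\lambda_i$ as a root of the minimal polynomial of $\mathrm{Rc}$. *)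

theory Defs
  imports
    "HOL-Analysis.Analysis"
    "HOL-Algebra.Group"
    "HOL-Computational_Algebra.Polynomial"
    "HOL-Library.Function_Algebras"
begin

text \<open>Tangent vectors and vector fields are function-valued below, and inherit the pointwise
  real vector space structure, so that \<open>subspace\<close>, \<open>span\<close>, \<open>independent\<close>, \<dots> apply to them.\<close>

instantiation "fun" :: (type, real_vector) real_vector
begin

definition scaleR_fun :: "real \<Rightarrow> ('a \<Rightarrow> 'b) \<Rightarrow> 'a \<Rightarrow> 'b"
  where "scaleR_fun a f = (\<lambda>x. a *\<^sub>R f x)"

instance
  by standard (simp_all add: scaleR_fun_def fun_eq_iff algebra_simps)

end


section \<open>Smooth manifolds\<close>

text \<open>Meant for open \<open>S\<close>; \<open>C_k_on k S f\<close> says that \<open>f\<close> is \<open>k\<close> times continuously differentiable.\<close>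

primrec C_k_on :: "nat \<Rightarrow> 'a::real_normed_vector set \<Rightarrow> ('a \<Rightarrow> 'b::real_normed_vector) \<Rightarrow> bool" where
  "C_k_on 0 S f \<longleftrightarrow> continuous_on S f"
| "C_k_on (Suc k) S f \<longleftrightarrow>
     (\<forall>x\<in>S. f differentiable (at x)) \<and> (\<forall>v. C_k_on k S (\<lambda>x. frechet_derivative f (at x) v))"

definition smooth_on :: "'a::real_normed_vector set \<Rightarrow> ('a \<Rightarrow> 'b::real_normed_vector) \<Rightarrow> bool"
  where "smooth_on S f \<longleftrightarrow> (\<forall>k. C_k_on k S f)"

text \<open>A chart is a pair \<open>(U, c)\<close> of a domain and a coordinate map; an atlas is a set of charts.
  The manifold is the whole type \<open>'m\<close>, and its dimension is that of the model space \<open>'e\<close>.\<close>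

type_synonym ('m, 'e) chart = "'m set \<times> ('m \<Rightarrow> 'e)"

locale smooth_manifold =
  fixes A :: "('m::{t2_space, second_countable_topology}, 'e::euclidean_space) chart set"
  assumes chart_open: "(U, c) \<in> A \<Longrightarrow> open U \<and> open (c ` U)"
    and chart_homeo: "(U, c) \<in> A \<Longrightarrow> homeomorphism U (c ` U) c (inv_into U c)"
    and charts_cover: "(\<Union>(U, c)\<in>A. U) = UNIV"
    and charts_compatible:
      "(U, c) \<in> A \<Longrightarrow> (V, d) \<in> A \<Longrightarrow> smooth_on (c ` (U \<inter> V)) (d \<circ> inv_into U c)"

definition smooth_map ::
    "('m::topological_space, 'e::real_normed_vector) chart set \<Rightarrow>
     ('n::topological_space, 'f::real_normed_vector) chart set \<Rightarrow> ('m \<Rightarrow> 'n) \<Rightarrow> bool"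
  where "smooth_map A B \<phi> \<longleftrightarrow> continuous_on UNIV \<phi> \<and>
    (\<forall>(U, c)\<in>A. \<forall>(V, d)\<in>B. smooth_on (c ` (U \<inter> \<phi> -` V)) (d \<circ> \<phi> \<circ> inv_into U c))"

definition diffeomorphism ::
    "('m::topological_space, 'e::real_normed_vector) chart set \<Rightarrow>
     ('n::topological_space, 'f::real_normed_vector) chart set \<Rightarrow> ('m \<Rightarrow> 'n) \<Rightarrow> bool"
  where "diffeomorphism A B \<phi> \<longleftrightarrow>
    bij \<phi> \<and> smooth_map A B \<phi> \<and> smooth_map B A (inv_into UNIV \<phi>)"

definition prod_atlas :: "('m, 'e) chart set \<Rightarrow> ('n, 'f) chart set \<Rightarrow> ('m \<times> 'n, 'e \<times> 'f) chart set"
  where "prod_atlas A B = {(U \<times> V, map_prod c d) | U c V d. (U, c) \<in> A \<and> (V, d) \<in> B}"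

definition smooth_fun_on ::
    "('m::topological_space, 'e::real_normed_vector) chart set \<Rightarrow> 'm set \<Rightarrow> ('m \<Rightarrow> real) \<Rightarrow> bool"
  where "smooth_fun_on A W f \<longleftrightarrow> (\<forall>(U, c)\<in>A. smooth_on (c ` (U \<inter> W)) (f \<circ> inv_into U c))"

definition smooth_at ::
    "('m::topological_space, 'e::real_normed_vector) chart set \<Rightarrow> 'm \<Rightarrow> ('m \<Rightarrow> real) \<Rightarrow> bool"
  where "smooth_at A p f \<longleftrightarrow> (\<exists>W. open W \<and> p \<in> W \<and> smooth_fun_on A W f)"


section \<open>Tangent vectors and vector fields\<close>

text \<open>Tangent vectors at \<open>p\<close> are the derivations at \<open>p\<close> of the functions that are smooth near \<open>p\<close>;
  such a derivation only depends on germs at \<open>p\<close>. As elements of a function type they are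
  normalised to be \<open>0\<close> on functions that are not smooth near \<open>p\<close>.\<close>

type_synonym 'm tangent = "('m \<Rightarrow> real) \<Rightarrow> real"

definition tangent_space ::
    "('m::topological_space, 'e::real_normed_vector) chart set \<Rightarrow> 'm \<Rightarrow> 'm tangent set"
  where "tangent_space A p = {v.
    (\<forall>f h. smooth_at A p f \<longrightarrow> smooth_at A p h \<longrightarrow>
        v (\<lambda>x. f x + h x) = v f + v h \<and>
        v (\<lambda>x. f x * h x) = v f * h p + f p * v h) \<and>
    (\<forall>a f. smooth_at A p f \<longrightarrow> v (\<lambda>x. a * f x) = a * v f) \<and>
    (\<forall>f. \<not> smooth_at A p f \<longrightarrow> v f = 0)}"

definition differential ::
    "('n::topological_space, 'f::real_normed_vector) chart set \<Rightarrow> ('m \<Rightarrow> 'n) \<Rightarrow> 'm \<Rightarrow>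
     'm tangent \<Rightarrow> 'n tangent"
  where "differential B \<phi> p v = (\<lambda>f. if smooth_at B (\<phi> p) f then v (f \<circ> \<phi>) else 0)"

definition vector_fields ::
    "('m::topological_space, 'e::real_normed_vector) chart set \<Rightarrow> ('m \<Rightarrow> 'm tangent) set"
  where "vector_fields A = {X. (\<forall>p. X p \<in> tangent_space A p) \<and>
    (\<forall>W f. open W \<longrightarrow> smooth_fun_on A W f \<longrightarrow> smooth_fun_on A W (\<lambda>p. X p f))}"

definition vf_bracket ::
    "('m::topological_space, 'e::real_normed_vector) chart set \<Rightarrow>
     ('m \<Rightarrow> 'm tangent) \<Rightarrow> ('m \<Rightarrow> 'm tangent) \<Rightarrow> 'm \<Rightarrow> 'm tangent"
  where "vf_bracket A X Y = (\<lambda>p f.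
    if smooth_at A p f then X p (\<lambda>q. Y q f) - Y p (\<lambda>q. X q f) else 0)"


section \<open>Pseudo-Riemannian metrics and the Levi-Civita connection\<close>

type_synonym 'm metric = "'m \<Rightarrow> 'm tangent \<Rightarrow> 'm tangent \<Rightarrow> real"

definition nondegenerate_on :: "('v::real_vector \<Rightarrow> 'v \<Rightarrow> real) \<Rightarrow> 'v set \<Rightarrow> bool"
  where "nondegenerate_on b V \<longleftrightarrow> (\<forall>u\<in>V. (\<forall>w\<in>V. b u w = 0) \<longrightarrow> u = 0)"

definition pseudo_riemannian ::
    "('m::topological_space, 'e::real_normed_vector) chart set \<Rightarrow> 'm metric \<Rightarrow> bool"
  where "pseudo_riemannian A g \<longleftrightarrow>
    (\<forall>p. \<forall>u\<in>tangent_space A p. \<forall>v\<in>tangent_space A p. g p u v = g p v u) \<and>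
    (\<forall>p. \<forall>u\<in>tangent_space A p. \<forall>v\<in>tangent_space A p. \<forall>w\<in>tangent_space A p. \<forall>a.
        g p (a *\<^sub>R u + v) w = a * g p u w + g p v w) \<and>
    (\<forall>p. nondegenerate_on (g p) (tangent_space A p)) \<and>
    (\<forall>X\<in>vector_fields A. \<forall>Y\<in>vector_fields A. smooth_fun_on A UNIV (\<lambda>p. g p (X p) (Y p)))"

definition isometry_group ::
    "('m::topological_space, 'e::real_normed_vector) chart set \<Rightarrow> 'm metric \<Rightarrow> ('m \<Rightarrow> 'm) set"
  where "isometry_group A g = {\<phi>. diffeomorphism A A \<phi> \<and>
    (\<forall>p. \<forall>u\<in>tangent_space A p. \<forall>w\<in>tangent_space A p.
        g (\<phi> p) (differential A \<phi> p u) (differential A \<phi> p w) = g p u w)}"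

definition affine_connection ::
    "('m::topological_space, 'e::real_normed_vector) chart set \<Rightarrow>
     (('m \<Rightarrow> 'm tangent) \<Rightarrow> ('m \<Rightarrow> 'm tangent) \<Rightarrow> ('m \<Rightarrow> 'm tangent)) \<Rightarrow> bool"
  where "affine_connection A D \<longleftrightarrow>
    (\<forall>X\<in>vector_fields A. \<forall>Y\<in>vector_fields A. D X Y \<in> vector_fields A) \<and>
    (\<forall>X\<in>vector_fields A. \<forall>Y\<in>vector_fields A. \<forall>Z\<in>vector_fields A.
        D (X + Y) Z = D X Z + D Y Z \<and> D X (Y + Z) = D X Y + D X Z) \<and>
    (\<forall>X\<in>vector_fields A. \<forall>Y\<in>vector_fields A. \<forall>f. smooth_fun_on A UNIV f \<longrightarrow>
        D (\<lambda>p. f p *\<^sub>R X p) Y = (\<lambda>p. f p *\<^sub>R D X Y p) \<and>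
        D X (\<lambda>p. f p *\<^sub>R Y p) = (\<lambda>p. X p f *\<^sub>R Y p + f p *\<^sub>R D X Y p))"

definition is_levi_civita ::
    "('m::topological_space, 'e::real_normed_vector) chart set \<Rightarrow> 'm metric \<Rightarrow>
     (('m \<Rightarrow> 'm tangent) \<Rightarrow> ('m \<Rightarrow> 'm tangent) \<Rightarrow> ('m \<Rightarrow> 'm tangent)) \<Rightarrow> bool"
  where "is_levi_civita A g D \<longleftrightarrow> affine_connection A D \<and>
    (\<forall>X\<in>vector_fields A. \<forall>Y\<in>vector_fields A. D X Y - D Y X = vf_bracket A X Y) \<and>
    (\<forall>X\<in>vector_fields A. \<forall>Y\<in>vector_fields A. \<forall>Z\<in>vector_fields A. \<forall>p.
        X p (\<lambda>q. g q (Y q) (Z q)) = g p (D X Y p) (Z p) + g p (Y p) (D X Z p))"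

text \<open>The Levi-Civita connection is determined only on smooth vector fields, so as a total
  function it is picked by \<open>SOME\<close>; its values on other arguments are irrelevant.\<close>

definition levi_civita ::
    "('m::topological_space, 'e::real_normed_vector) chart set \<Rightarrow> 'm metric \<Rightarrow>
     ('m \<Rightarrow> 'm tangent) \<Rightarrow> ('m \<Rightarrow> 'm tangent) \<Rightarrow> ('m \<Rightarrow> 'm tangent)"
  where "levi_civita A g = (SOME D. is_levi_civita A g D)"

definition curvature ::
    "('m::topological_space, 'e::real_normed_vector) chart set \<Rightarrow> 'm metric \<Rightarrow>
     ('m \<Rightarrow> 'm tangent) \<Rightarrow> ('m \<Rightarrow> 'm tangent) \<Rightarrow> ('m \<Rightarrow> 'm tangent) \<Rightarrow> ('m \<Rightarrow> 'm tangent)"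
  where "curvature A g X Y Z =
    levi_civita A g X (levi_civita A g Y Z) - levi_civita A g Y (levi_civita A g X Z)
      - levi_civita A g (vf_bracket A X Y) Z"


section \<open>Linear algebra on subspaces\<close>

text \<open>Trace of an endomorphism \<open>T\<close> of a finite-dimensional subspace \<open>V\<close>.\<close>

definition trace_on :: "'v::real_vector set \<Rightarrow> ('v \<Rightarrow> 'v) \<Rightarrow> real"
  where "trace_on V T =
    (let B = (SOME B. independent B \<and> span B = V) in \<Sum>b\<in>B. representation B (T b) b)"

definition poly_op :: "real poly \<Rightarrow> ('v::real_vector \<Rightarrow> 'v) \<Rightarrow> 'v \<Rightarrow> 'v"
  where "poly_op p T u = (\<Sum>i\<le>degree p. coeff p i *\<^sub>R (T ^^ i) u)"

definition minimal_polynomial :: "'v::real_vector set \<Rightarrow> ('v \<Rightarrow> 'v) \<Rightarrow> real poly"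
  where "minimal_polynomial V T = (THE p. lead_coeff p = 1 \<and> (\<forall>u\<in>V. poly_op p T u = 0) \<and>
    (\<forall>q. q \<noteq> 0 \<longrightarrow> (\<forall>u\<in>V. poly_op q T u = 0) \<longrightarrow> degree p \<le> degree q))"

text \<open>The complexification of \<open>V\<close> is \<open>V \<times> V\<close>, where \<open>(u, w)\<close> stands for \<open>u \<otimes> 1 + w \<otimes> \<i>\<close>.\<close>

definition complexification :: "'v set \<Rightarrow> ('v \<times> 'v) set"
  where "complexification V = V \<times> V"

definition cscale :: "complex \<Rightarrow> 'v::real_vector \<times> 'v \<Rightarrow> 'v \<times> 'v"
  where "cscale z x =
    (Re z *\<^sub>R fst x - Im z *\<^sub>R snd x, Re z *\<^sub>R snd x + Im z *\<^sub>R fst x)"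

definition complexify_op :: "('v \<Rightarrow> 'v) \<Rightarrow> 'v \<times> 'v \<Rightarrow> 'v \<times> 'v"
  where "complexify_op T = map_prod T T"

definition complex_eigenvalues :: "'v::real_vector set \<Rightarrow> ('v \<Rightarrow> 'v) \<Rightarrow> complex set"
  where "complex_eigenvalues V T =
    {z. \<exists>x\<in>complexification V. x \<noteq> 0 \<and> complexify_op T x = cscale z x}"

definition eigen_multiplicity :: "'v::real_vector set \<Rightarrow> ('v \<Rightarrow> 'v) \<Rightarrow> complex \<Rightarrow> nat"
  where "eigen_multiplicity V T z =
    Polynomial.order z (map_poly complex_of_real (minimal_polynomial V T))"

definition associated_subspace ::
    "'v::real_vector set \<Rightarrow> ('v \<Rightarrow> 'v) \<Rightarrow> complex \<Rightarrow> ('v \<times> 'v) set"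
  where "associated_subspace V T z = {x \<in> complexification V.
    ((\<lambda>y. complexify_op T y - cscale z y) ^^ eigen_multiplicity V T z) x = 0}"

text \<open>\<open>W\<close> is the internal direct sum of the \<open>E i\<close>, \<open>i \<in> I\<close> (\<open>I\<close> finite); the empty sum is \<open>{0}\<close>.\<close>

definition is_direct_sum :: "'w::ab_group_add set \<Rightarrow> 'i set \<Rightarrow> ('i \<Rightarrow> 'w set) \<Rightarrow> bool"
  where "is_direct_sum W I E \<longleftrightarrow>
    W = {\<Sum>i\<in>I. x i | x. \<forall>i\<in>I. x i \<in> E i} \<and>
    (\<forall>x. (\<forall>i\<in>I. x i \<in> E i) \<longrightarrow> (\<Sum>i\<in>I. x i) = 0 \<longrightarrow> (\<forall>i\<in>I. x i = 0))"


section \<open>Lie groups with a left-invariant metric\<close>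

locale lie_group = smooth_manifold A + group G
  for A :: "('m::{t2_space, second_countable_topology}, 'e::euclidean_space) chart set"
    and G :: "'m monoid" +
  assumes carrier_UNIV: "carrier G = UNIV"
    and smooth_mult: "smooth_map (prod_atlas A A) A (\<lambda>(x, y). x \<otimes>\<^bsub>G\<^esub> y)"
    and smooth_inv: "smooth_map A A (\<lambda>x. inv\<^bsub>G\<^esub> x)"

text \<open>The Lie algebra consists of the left-invariant vector fields; its bracket is \<open>vf_bracket A\<close>.\<close>

definition lie_algebra ::
    "('m::topological_space, 'e::real_normed_vector) chart set \<Rightarrow> 'm monoid \<Rightarrow>
     ('m \<Rightarrow> 'm tangent) set"
  where "lie_algebra A G = {X \<in> vector_fields A.
    \<forall>a p. X (a \<otimes>\<^bsub>G\<^esub> p) = differential A (\<lambda>x. a \<otimes>\<^bsub>G\<^esub> x) p (X p)}"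

definition lie_center ::
    "('m::topological_space, 'e::real_normed_vector) chart set \<Rightarrow> 'm monoid \<Rightarrow>
     ('m \<Rightarrow> 'm tangent) set"
  where "lie_center A G = {Z \<in> lie_algebra A G. \<forall>X\<in>lie_algebra A G. vf_bracket A Z X = 0}"

text \<open>Nilpotent of class exactly two. For a connected Lie group this is a condition on its Lie
  algebra.\<close>

definition two_step_nilpotent ::
    "('m::topological_space, 'e::real_normed_vector) chart set \<Rightarrow> 'm monoid \<Rightarrow> bool"
  where "two_step_nilpotent A G \<longleftrightarrow>
    (\<forall>X\<in>lie_algebra A G. \<forall>Y\<in>lie_algebra A G. \<forall>Z\<in>lie_algebra A G.
        vf_bracket A (vf_bracket A X Y) Z = 0) \<and>
    (\<exists>X\<in>lie_algebra A G. \<exists>Y\<in>lie_algebra A G. vf_bracket A X Y \<noteq> 0)"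

definition left_invariant_metric ::
    "('m::topological_space, 'e::real_normed_vector) chart set \<Rightarrow> 'm monoid \<Rightarrow> 'm metric \<Rightarrow> bool"
  where "left_invariant_metric A G g \<longleftrightarrow> pseudo_riemannian A g \<and>
    (\<forall>a p. \<forall>u\<in>tangent_space A p. \<forall>w\<in>tangent_space A p.
        g (a \<otimes>\<^bsub>G\<^esub> p) (differential A (\<lambda>x. a \<otimes>\<^bsub>G\<^esub> x) p u) (differential A (\<lambda>x. a \<otimes>\<^bsub>G\<^esub> x) p w)
          = g p u w)"

definition induced_form ::
    "'m monoid \<Rightarrow> 'm metric \<Rightarrow> ('m \<Rightarrow> 'm tangent) \<Rightarrow> ('m \<Rightarrow> 'm tangent) \<Rightarrow> real"
  where "induced_form G g X Y = g \<one>\<^bsub>G\<^esub> (X \<one>\<^bsub>G\<^esub>) (Y \<one>\<^bsub>G\<^esub>)"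

definition center_perp ::
    "('m::topological_space, 'e::real_normed_vector) chart set \<Rightarrow> 'm monoid \<Rightarrow> 'm metric \<Rightarrow>
     ('m \<Rightarrow> 'm tangent) set"
  where "center_perp A G g =
    {X \<in> lie_algebra A G. \<forall>Z\<in>lie_center A G. induced_form G g X Z = 0}"

definition ricci_tensor ::
    "('m::topological_space, 'e::real_normed_vector) chart set \<Rightarrow> 'm monoid \<Rightarrow> 'm metric \<Rightarrow>
     ('m \<Rightarrow> 'm tangent) \<Rightarrow> ('m \<Rightarrow> 'm tangent) \<Rightarrow> real"
  where "ricci_tensor A G g u w = trace_on (lie_algebra A G) (\<lambda>\<xi>. curvature A g \<xi> u w)"

definition ricci_operator ::
    "('m::topological_space, 'e::real_normed_vector) chart set \<Rightarrow> 'm monoid \<Rightarrow> 'm metric \<Rightarrow>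
     ('m \<Rightarrow> 'm tangent) \<Rightarrow> ('m \<Rightarrow> 'm tangent)"
  where "ricci_operator A G g u = (THE r. r \<in> lie_algebra A G \<and>
    (\<forall>w\<in>lie_algebra A G. induced_form G g r w = ricci_tensor A G g u w))"

text \<open>The fibre at \<open>p\<close> of the left-invariant distribution given by a subspace of the Lie algebra.\<close>

definition left_invariant_distribution ::
    "('m \<Rightarrow> 'm tangent) set \<Rightarrow> 'm \<Rightarrow> 'm tangent set"
  where "left_invariant_distribution V p = {X p | X. X \<in> V}"

definition preserves_distribution ::
    "('m::topological_space, 'e::real_normed_vector) chart set \<Rightarrow> ('m \<Rightarrow> 'm) \<Rightarrow>
     ('m \<Rightarrow> 'm tangent set) \<Rightarrow> bool"
  where "preserves_distribution A \<phi> \<Delta> \<longleftrightarrow> (\<forall>p. differential A \<phi> p ` \<Delta> p = \<Delta> (\<phi> p))"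

definition isometry_group_spl ::
    "('m::topological_space, 'e::real_normed_vector) chart set \<Rightarrow> 'm monoid \<Rightarrow> 'm metric \<Rightarrow>
     ('m \<Rightarrow> 'm) set"
  where "isometry_group_spl A G g = {\<phi> \<in> isometry_group A g.
    preserves_distribution A \<phi> (left_invariant_distribution (center_perp A G g)) \<and>
    preserves_distribution A \<phi> (left_invariant_distribution (lie_center A G))}"

end

theory Submission
  imports Defs
begin

text \<open>An isometry \<open>\<phi>\<close> preserves the Levi-Civita connection, by the Koszul formula, and hence the
  curvature. The curvature is tensorial, so identifying \<open>T\<^sub>pN\<close> and \<open>T\<^bsub>\<phi>(p)\<^esub>N\<close> with the Lie algebra
  by left translations turns \<open>d\<phi>\<^sub>p\<close> into a linear automorphism \<open>T\<close> of the Lie algebra that preserves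
  the inner product and the curvature, and so commutes with the Ricci operator. The
  complexification of \<open>T\<close> then preserves each of the subspaces associated to the eigenvalues, and
  with them their sums, the complexifications of the center and of its orthogonal complement.

  Existence of the Levi-Civita connection and tensoriality need no partitions of unity, because
  a Lie group has global frames of left-invariant fields.\<close>


section \<open>Calculus of smooth functions\<close>

text \<open>An isometry need not send left-invariant fields to left-invariant fields, so
  push-forward does not act on the Lie algebra. The comparison is therefore made at one point
  \<open>p\<close> at a time: the automorphism \<open>T\<close> depends on \<open>p\<close> and is
  tied to the push-forward only by the values at \<open>\<phi> p\<close>. Tensoriality is what
  permits exchanging a pushed field for the left-invariant one through the same vector.

  Tangent vectors are abstract derivations, so the link with calculus is Hadamard's lemma, which
  makes a derivation a combination of partial derivatives. From this come both facts on which the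
  Lie algebra rests: it is finite-dimensional, so that traces and dual bases exist, and every
  tangent vector extends to a smooth left-invariant field, so that evaluation at any point
  identifies the Lie algebra with the tangent space there.

  The trace, the connection and the Frechet derivative are given by choice operators. Each is made
  accessible through a property that determines it on the relevant arguments: independence of the
  basis, the Koszul formula, an explicit derivative.\<close>

lemma C_k_on_cong:
  assumes "open S" "\<And>x. x \<in> S \<Longrightarrow> f x = g x" "C_k_on k S f"
  shows "C_k_on k S g"
  using assms(2,3)
proof (induction k arbitrary: f g)
  case 0
  then show ?case by (auto cong: continuous_on_cong)
next
  case (Suc k)
  have D: "(g has_derivative F) (at x) \<longleftrightarrow> (f has_derivative F) (at x)" if "x \<in> S" for x F
    using Suc.prems(1) has_derivative_transform_within_open[OF _ assms(1) that] by metis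
  \<comment> \<open>\<open>frechet_derivative\<close> is a choice among the derivatives at
    \<open>x\<close>; equal sets of derivatives make the choices equal.\<close>
  have "frechet_derivative f (at x) = frechet_derivative g (at x)" if "x \<in> S" for x
    unfolding frechet_derivative_def using D[OF that] by simp
  moreover have "g differentiable (at x)" if "x \<in> S" for x
    using Suc.prems(2) that D[OF that] by (auto simp: differentiable_def)
  ultimately show ?case
    using Suc.prems(2) Suc.IH[of "\<lambda>x. frechet_derivative f (at x) v" "\<lambda>x. frechet_derivative g (at x) v" for v]
    by simp
qed

lemma C_k_on_subset: "C_k_on k S f \<Longrightarrow> T \<subseteq> S \<Longrightarrow> C_k_on k T f"
  by (induction k arbitrary: f) (auto intro: continuous_on_subset)

text \<open>Derivatives are taken with the full filter \<open>at x\<close>, independently of the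
  set, so nothing has to be glued.\<close>

lemma C_k_on_local:
  assumes "\<And>x. x \<in> S \<Longrightarrow> \<exists>T. open T \<and> x \<in> T \<and> C_k_on k T f"
  shows "C_k_on k S f"
  using assms
proof (induction k arbitrary: f)
  case 0
  then show ?case
    by (metis C_k_on.simps(1) continuous_at_imp_continuous_on continuous_on_eq_continuous_at)
next
  case (Suc k)
  show ?case
    using Suc.prems by (auto intro!: Suc.IH) (metis C_k_on.simps(2))+
qed

lemma C_k_on_imp_continuous_on: "C_k_on k S f \<Longrightarrow> continuous_on S f"
  by (cases k) (auto intro!: continuous_at_imp_continuous_on differentiable_imp_continuous_within)

lemma C_k_on_SucD: "C_k_on (Suc k) S f \<Longrightarrow> C_k_on k S f"
proof (induction k arbitrary: f)
  case 0
  show ?case using C_k_on_imp_continuous_on[OF 0] by simp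
next
  case (Suc k)
  have "C_k_on k S (\<lambda>x. frechet_derivative f (at x) v)" for v
    by (rule Suc.IH) (use Suc.prems in simp)
  moreover have "\<forall>x\<in>S. f differentiable (at x)" using Suc.prems by simp
  ultimately show ?case by (subst C_k_on.simps(2)) blast
qed

text \<open>Replaces the chosen \<open>frechet_derivative\<close> by an explicit derivative
  \<open>F\<close>, the form in which product and chain rule deliver it.\<close>

lemma C_k_on_SucI:
  assumes "open S" "\<And>x. x \<in> S \<Longrightarrow> (f has_derivative F x) (at x)"
    and "\<And>v. C_k_on k S (\<lambda>x. F x v)"
  shows "C_k_on (Suc k) S f"
proof -
  have "F x = frechet_derivative f (at x)" if "x \<in> S" for x
    using assms(2)[OF that] by (rule frechet_derivative_at)
  then have "C_k_on k S (\<lambda>x. frechet_derivative f (at x) v)" for v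
    by (intro C_k_on_cong[OF assms(1) _ assms(3)]) auto
  then show ?thesis
    using assms(2) by (auto simp: differentiable_def)
qed

lemma C_k_on_SucE:
  assumes "C_k_on (Suc k) S f" "x \<in> S"
  shows "(f has_derivative frechet_derivative f (at x)) (at x)"
  using assms by (subst frechet_derivative_works[symmetric]) simp

lemma C_k_on_const: "open S \<Longrightarrow> C_k_on k S (\<lambda>x. c)"
  by (induction k arbitrary: c) (auto intro!: C_k_on_SucI[where F="\<lambda>x v. 0"] simp del: C_k_on.simps(2))

lemma C_k_on_bounded_linear:
  assumes "open S" "bounded_linear h"
  shows "C_k_on k S h"
proof (cases k)
  case 0
  then show ?thesis using assms by (simp add: linear_continuous_on)
next
  case (Suc k')
  show ?thesis unfolding Suc
    by (rule C_k_on_SucI[where F="\<lambda>x. h"])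
       (use assms in \<open>auto intro: bounded_linear_imp_has_derivative C_k_on_const\<close>)
qed

lemma C_k_on_add:
  assumes "open S" "C_k_on k S f" "C_k_on k S g"
  shows "C_k_on k S (\<lambda>x. f x + g x)"
  using assms(2,3)
proof (induction k arbitrary: f g)
  case 0
  then show ?case by (auto intro: continuous_intros)
next
  case (Suc k)
  show ?case
    by (rule C_k_on_SucI[OF assms(1) has_derivative_add[OF C_k_on_SucE C_k_on_SucE]])
       (use Suc in auto)
qed

lemma C_k_on_sum:
  assumes "open S" "\<And>i. i \<in> I \<Longrightarrow> C_k_on k S (f i)"
  shows "C_k_on k S (\<lambda>x. \<Sum>i\<in>I. f i x)"
  using assms(2) by (induction I rule: infinite_finite_induct)
    (auto intro: C_k_on_add C_k_on_const assms(1))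

text \<open>One product rule that serves real multiplication, scalar multiplication and the inner
  product.\<close>

lemma (in bounded_bilinear) C_k_on:
  assumes "open S" "C_k_on k S f" "C_k_on k S g"
  shows "C_k_on k S (\<lambda>x. prod (f x) (g x))"
  using assms(2,3)
proof (induction k arbitrary: f g)
  case 0
  then show ?case by (auto intro: continuous_on)
next
  case (Suc k)
  have "C_k_on k S f" "C_k_on k S g"
    using Suc.prems by (auto intro: C_k_on_SucD simp del: C_k_on.simps)
  then show ?case
    by (intro C_k_on_SucI[OF assms(1) FDERIV[OF C_k_on_SucE C_k_on_SucE]])
       (use Suc in \<open>auto intro!: C_k_on_add Suc.IH assms(1)\<close>)
qed

text \<open>The chain rule applies the derivative of \<open>f\<close> at \<open>g x\<close> to a
  vector that itself moves with \<open>x\<close>, while \<open>C_k_on\<close> controls derivatives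
  only in fixed directions. Expanding the moving vector in \<open>Basis\<close> separates the two
  dependencies; this is why the middle space is Euclidean.\<close>

lemma C_k_on_compose:
  fixes f :: "'b::euclidean_space \<Rightarrow> 'c::real_normed_vector"
    and g :: "'a::real_normed_vector \<Rightarrow> 'b"
  assumes "open S" "open T" "g ` S \<subseteq> T" "C_k_on k T f" "C_k_on k S g"
  shows "C_k_on k S (\<lambda>x. f (g x))"
  using assms(3-)
proof (induction k arbitrary: f)
  case 0
  then show ?case by (auto intro: continuous_on_compose2)
next
  case (Suc k)
  let ?Df = "\<lambda>y. frechet_derivative f (at y)" and ?Dg = "\<lambda>x. frechet_derivative g (at x)"
  have Df: "(f has_derivative ?Df (g x)) (at (g x))" if "x \<in> S" for x
    using Suc.prems that by (auto intro!: C_k_on_SucE simp del: C_k_on.simps)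
  have Dg: "(g has_derivative ?Dg x) (at x)" if "x \<in> S" for x
    using Suc.prems that by (auto intro!: C_k_on_SucE simp del: C_k_on.simps)
  have g: "C_k_on k S g" using Suc.prems by (auto intro: C_k_on_SucD simp del: C_k_on.simps)
  show ?case
  proof (rule C_k_on_SucI[OF assms(1) has_derivative_compose[OF Dg Df]])
    fix v
    have "?Df (g x) (?Dg x v) = (\<Sum>b\<in>Basis. (?Dg x v \<bullet> b) *\<^sub>R ?Df (g x) b)" if "x \<in> S" for x
    proof -
      interpret D: bounded_linear "?Df (g x)" using Df[OF that] by (rule has_derivative_bounded_linear)
      show ?thesis
        by (subst (1) euclidean_representation[symmetric, of "?Dg x v"]) (simp only: D.sum D.scaleR)
    qed
    moreover have "C_k_on k S (\<lambda>x. \<Sum>b\<in>Basis. (?Dg x v \<bullet> b) *\<^sub>R ?Df (g x) b)"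
    proof (intro C_k_on_sum assms(1) bounded_bilinear.C_k_on[OF bounded_bilinear_scaleR])
      fix b
      show "C_k_on k S (\<lambda>x. ?Dg x v \<bullet> b)"
        by (rule bounded_bilinear.C_k_on[OF bounded_bilinear_inner assms(1) _ C_k_on_const[OF assms(1)]])
           (use Suc.prems in simp)
      show "C_k_on k S (\<lambda>x. ?Df (g x) b)"
        using Suc.IH[of "\<lambda>y. ?Df y b"] Suc.prems g by simp
    qed
    ultimately show "C_k_on k S (\<lambda>x. ?Df (g x) (?Dg x v))"
      by (auto intro!: C_k_on_cong[OF assms(1) _ \<open>C_k_on k S (\<lambda>x. \<Sum>b\<in>Basis. (?Dg x v \<bullet> b) *\<^sub>R ?Df (g x) b)\<close>])
  qed auto
qed

section \<open>Smoothness to all orders\<close>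

lemma smooth_on_cong:
  "open S \<Longrightarrow> (\<And>x. x \<in> S \<Longrightarrow> f x = g x) \<Longrightarrow> smooth_on S f \<Longrightarrow> smooth_on S g"
  unfolding smooth_on_def using C_k_on_cong by blast

lemma smooth_on_subset: "smooth_on S f \<Longrightarrow> T \<subseteq> S \<Longrightarrow> smooth_on T f"
  unfolding smooth_on_def using C_k_on_subset by blast

lemma smooth_on_local:
  "(\<And>x. x \<in> S \<Longrightarrow> \<exists>T. open T \<and> x \<in> T \<and> smooth_on T f) \<Longrightarrow> smooth_on S f"
  unfolding smooth_on_def using C_k_on_local by metis

lemma smooth_on_imp_continuous_on: "smooth_on S f \<Longrightarrow> continuous_on S f"
  unfolding smooth_on_def using C_k_on.simps(1) by blast

lemma smooth_on_has_derivative: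
  "smooth_on S f \<Longrightarrow> x \<in> S \<Longrightarrow> (f has_derivative frechet_derivative f (at x)) (at x)"
  unfolding smooth_on_def using C_k_on_SucE by blast

lemma smooth_on_frechet_derivative:
  "smooth_on S f \<Longrightarrow> smooth_on S (\<lambda>x. frechet_derivative f (at x) v)"
  unfolding smooth_on_def using C_k_on.simps(2) by blast

lemma smooth_on_const: "open S \<Longrightarrow> smooth_on S (\<lambda>x. c)"
  unfolding smooth_on_def using C_k_on_const by blast

lemma smooth_on_bounded_linear: "open S \<Longrightarrow> bounded_linear h \<Longrightarrow> smooth_on S h"
  unfolding smooth_on_def using C_k_on_bounded_linear by blast

lemma smooth_on_add: "open S \<Longrightarrow> smooth_on S f \<Longrightarrow> smooth_on S g \<Longrightarrow> smooth_on S (\<lambda>x. f x + g x)"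
  unfolding smooth_on_def using C_k_on_add by blast

lemma smooth_on_sum:
  assumes "open S" "\<And>i. i \<in> I \<Longrightarrow> smooth_on S (f i)"
  shows "smooth_on S (\<lambda>x. \<Sum>i\<in>I. f i x)"
  unfolding smooth_on_def
  by (intro allI C_k_on_sum assms(1)) (use assms(2) in \<open>simp add: smooth_on_def\<close>)

lemma smooth_on_mult:
  fixes f g :: "'a::real_normed_vector \<Rightarrow> real"
  shows "open S \<Longrightarrow> smooth_on S f \<Longrightarrow> smooth_on S g \<Longrightarrow> smooth_on S (\<lambda>x. f x * g x)"
  unfolding smooth_on_def using bounded_bilinear.C_k_on[OF bounded_bilinear_mult] by blast

lemma smooth_on_compose:
  fixes f :: "'b::euclidean_space \<Rightarrow> 'c::real_normed_vector"
  shows "open S \<Longrightarrow> open T \<Longrightarrow> g ` S \<subseteq> T \<Longrightarrow> smooth_on T f \<Longrightarrow> smooth_on S g \<Longrightarrow>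
    smooth_on S (\<lambda>x. f (g x))"
  unfolding smooth_on_def using C_k_on_compose by blast

section \<open>Integrals along segments and Hadamard's lemma\<close>

lemma segment_in_ball:
  fixes x0 :: "'a::real_normed_vector"
  assumes "x \<in> ball x0 r" "t \<in> {0..1}"
  shows "x0 + t *\<^sub>R (x - x0) \<in> ball x0 r"
proof -
  have "dist x0 (x0 + t *\<^sub>R (x - x0)) = t * dist x0 x"
    using assms(2) by (simp add: dist_norm norm_minus_commute)
  also have "\<dots> \<le> 1 * dist x0 x" using assms(2) by (intro mult_right_mono) auto
  finally show ?thesis using assms(1) by simp
qed

lemma continuous_on_segment_integrand:
  fixes F :: "'a::euclidean_space \<Rightarrow> real"
  assumes "continuous_on (ball x0 r) F"
  shows "continuous_on (ball x0 r \<times> cbox 0 1) (\<lambda>(x, t). t ^ m * F (x0 + t *\<^sub>R (x - x0)))"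
  unfolding split_beta
  by (intro continuous_intros continuous_on_compose2[OF assms])
     (auto intro: segment_in_ball simp del: mem_ball)

text \<open>Differentiating under the integral sign replaces \<open>F\<close> by a directional
  derivative and, by the chain rule, produces one more factor \<open>t\<close>. The weight
  \<open>t ^ m\<close> with arbitrary \<open>m\<close> is what makes the induction on
  \<open>k\<close> close.\<close>

lemma C_k_on_segment_integral:
  fixes F :: "'a::euclidean_space \<Rightarrow> real"
  assumes "smooth_on (ball x0 r) F"
  shows "C_k_on k (ball x0 r) (\<lambda>x. integral (cbox 0 1) (\<lambda>t. t ^ m * F (x0 + t *\<^sub>R (x - x0))))"
  using assms
proof (induction k arbitrary: F m)
  case 0
  have "continuous_on (ball x0 r \<times> cbox 0 1) (\<lambda>(x, t). t ^ m * F (x0 + t *\<^sub>R (x - x0)))"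
    using 0 by (intro continuous_on_segment_integrand smooth_on_imp_continuous_on)
  from integral_continuous_on_param[OF this] show ?case by simp
next
  case (Suc k)
  let ?S = "ball x0 r"
  define DF where "DF y = frechet_derivative F (at y)" for y
  \<comment> \<open>The Leibniz rule for parameter integrals asks for the derivative as a bounded
    linear function depending continuously on \<open>(x, t)\<close>. \<open>Blinfun\<close> is
    meaningful here for \<open>x\<close> in the ball and \<open>t\<close> in the unit
    interval.\<close>
  define fx where "fx x t = Blinfun (\<lambda>v. t ^ Suc m * DF (x0 + t *\<^sub>R (x - x0)) v)" for x t
  have DF: "(F has_derivative DF y) (at y)" if "y \<in> ?S" for y
    unfolding DF_def using smooth_on_has_derivative[OF Suc.prems that] .
  have smooth_DF: "smooth_on ?S (\<lambda>y. DF y v)" for v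
    unfolding DF_def using Suc.prems by (rule smooth_on_frechet_derivative)
  have fx: "blinfun_apply (fx x t) = (\<lambda>v. t ^ Suc m * DF (x0 + t *\<^sub>R (x - x0)) v)"
    if "x \<in> ?S" "t \<in> cbox 0 1" for x t
      proof -
    have "x0 + t *\<^sub>R (x - x0) \<in> ?S" using that by (intro segment_in_ball) auto
    from bounded_linear_const_mult[OF has_derivative_bounded_linear[OF DF[OF this]], of "t ^ Suc m"]
    show ?thesis unfolding fx_def by (rule bounded_linear_Blinfun_apply)
  qed
  \<comment> \<open>In finite dimension, continuity in operator norm may be tested on basis
    vectors.\<close>
  have cont: "continuous_on (?S \<times> cbox 0 1) (\<lambda>(x, t). fx x t)"
  proof (rule continuous_on_blinfun_componentwise)
    fix i :: 'a
    have "continuous_on (?S \<times> cbox 0 1) (\<lambda>(x, t). t ^ Suc m * DF (x0 + t *\<^sub>R (x - x0)) i)"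
      by (intro continuous_on_segment_integrand smooth_on_imp_continuous_on smooth_DF)
    then show "continuous_on (?S \<times> cbox 0 1) (\<lambda>z. blinfun_apply (case z of (x, t) \<Rightarrow> fx x t) i)"
      by (rule continuous_on_eq) (use fx in auto)
  qed
  have cont_x: "continuous_on (cbox 0 1) (fx x)" if "x \<in> ?S" for x
  proof -
    have "continuous_on (cbox 0 1) (\<lambda>t. case (x, t) of (x, t) \<Rightarrow> fx x t)"
      by (rule continuous_on_compose2[OF cont]) (use that in \<open>auto intro!: continuous_intros\<close>)
    then show ?thesis by simp
  qed
  have D_within: "((\<lambda>x. integral (cbox 0 1) (\<lambda>t. t ^ m * F (x0 + t *\<^sub>R (x - x0)))) has_derivative
      integral (cbox 0 1) (fx x)) (at x within ?S)" if x: "x \<in> ?S" for x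
  proof (rule leibniz_rule[OF _ _ cont x convex_ball])
    fix x t assume x: "x \<in> ?S" and t: "t \<in> cbox (0::real) 1"
    then have y: "x0 + t *\<^sub>R (x - x0) \<in> ?S" by (intro segment_in_ball) auto
    interpret D: bounded_linear "DF (x0 + t *\<^sub>R (x - x0))"
      using DF[OF y] by (rule has_derivative_bounded_linear)
    have "((\<lambda>x. x0 + t *\<^sub>R (x - x0)) has_derivative (\<lambda>v. t *\<^sub>R v)) (at x within ?S)"
      by (auto intro!: derivative_eq_intros)
    from has_derivative_mult_right[OF has_derivative_compose[OF this DF[OF y]], of "t ^ m"]
    show "((\<lambda>x. t ^ m * F (x0 + t *\<^sub>R (x - x0))) has_derivative blinfun_apply (fx x t)) (at x within ?S)"
      unfolding fx[OF x t] by (simp add: D.scaleR mult_ac)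
  next
    fix x assume x: "x \<in> ?S"
    have "continuous_on (cbox 0 1) (\<lambda>t. case (x, t) of (x, t) \<Rightarrow> t ^ m * F (x0 + t *\<^sub>R (x - x0)))"
      by (rule continuous_on_compose2[OF continuous_on_segment_integrand[OF smooth_on_imp_continuous_on[OF Suc.prems]]])
         (use x in \<open>auto intro!: continuous_intros\<close>)
    then show "(\<lambda>t. t ^ m * F (x0 + t *\<^sub>R (x - x0))) integrable_on cbox 0 1"
      by (intro integrable_continuous) simp
  qed
  have D: "((\<lambda>x. integral (cbox 0 1) (\<lambda>t. t ^ m * F (x0 + t *\<^sub>R (x - x0)))) has_derivative
      integral (cbox 0 1) (fx x)) (at x)" if "x \<in> ?S" for x
    using D_within[OF that] at_within_open[OF that open_ball] by simp
  have apply_fx: "integral (cbox 0 1) (fx x) v = integral (cbox 0 1) (\<lambda>t. t ^ Suc m * DF (x0 + t *\<^sub>R (x - x0)) v)"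
    if "x \<in> ?S" for x v
    using that fx by (subst blinfun_apply_integral[OF integrable_continuous[OF cont_x]])
       (auto intro!: integral_cong)
  have C_k: "C_k_on k ?S (\<lambda>x. integral (cbox 0 1) (fx x) v)" for v
    by (rule C_k_on_cong[OF open_ball apply_fx[symmetric] Suc.IH[OF smooth_DF]])
  show ?case
    by (rule C_k_on_SucI[where F="\<lambda>x. blinfun_apply (integral (cbox 0 1) (fx x))", OF open_ball D C_k])
qed

text \<open>The fundamental theorem of calculus along the segment from \<open>x0\<close> to
  \<open>x\<close>: \<open>H b\<close> is the mean of the partial derivative in direction
  \<open>b\<close> over that segment. It is a first-order Taylor formula whose coefficients are
  still smooth, hence accessible to derivations.\<close>

lemma hadamard:
  fixes F :: "'a::euclidean_space \<Rightarrow> real"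
  assumes F: "smooth_on (ball x0 r) F" and r: "r > 0"
  obtains H where "\<And>b. smooth_on (ball x0 r) (H b)"
    and "\<And>x. x \<in> ball x0 r \<Longrightarrow> F x = F x0 + (\<Sum>b\<in>Basis. ((x - x0) \<bullet> b) * H b x)"
    and "\<And>b. H b x0 = frechet_derivative F (at x0) b"
proof
  define DF where "DF y = frechet_derivative F (at y)" for y
  \<comment> \<open>The factor \<open>t ^ 0\<close> makes this the case \<open>m = 0\<close> of
    \<open>C_k_on_segment_integral\<close>.\<close>
  define H where "H b x = integral (cbox 0 1) (\<lambda>t::real. t ^ 0 * DF (x0 + t *\<^sub>R (x - x0)) b)" for b x
  have smooth_DF: "smooth_on (ball x0 r) (\<lambda>y. DF y v)" for v
    unfolding DF_def using F by (rule smooth_on_frechet_derivative)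
  have DF: "(F has_derivative DF y) (at y)" if "y \<in> ball x0 r" for y
    unfolding DF_def using smooth_on_has_derivative[OF F that] .
  show "smooth_on (ball x0 r) (H b)" for b
    unfolding smooth_on_def H_def using C_k_on_segment_integral[OF smooth_DF] by blast
  show "H b x0 = frechet_derivative F (at x0) b" for b
    by (simp add: H_def DF_def)
  fix x assume x: "x \<in> ball x0 r"
  have in_ball: "x0 + t *\<^sub>R (x - x0) \<in> ball x0 r" if "t \<in> {0..1}" for t
    using segment_in_ball[OF x that] .
  have deriv: "((\<lambda>t. F (x0 + t *\<^sub>R (x - x0))) has_vector_derivative DF (x0 + t *\<^sub>R (x - x0)) (x - x0))
      (at t within {0..1})" if "t \<in> {0..1}" for t
  proof -
    interpret D: bounded_linear "DF (x0 + t *\<^sub>R (x - x0))"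
      using DF[OF in_ball[OF that]] by (rule has_derivative_bounded_linear)
    have "((\<lambda>t. x0 + t *\<^sub>R (x - x0)) has_derivative (\<lambda>s. s *\<^sub>R (x - x0))) (at t within {0..1})"
      by (auto intro!: derivative_eq_intros)
    from has_derivative_compose[OF this DF[OF in_ball[OF that]]] show ?thesis
      by (simp add: has_vector_derivative_def D.scaleR)
  qed
  have "F x = F x0 + integral {0..1} (\<lambda>t. DF (x0 + t *\<^sub>R (x - x0)) (x - x0))"
    using integral_unique[OF fundamental_theorem_of_calculus[OF _ deriv]] by simp
  also have "integral {0..1} (\<lambda>t. DF (x0 + t *\<^sub>R (x - x0)) (x - x0)) =
      integral {0..1} (\<lambda>t. \<Sum>b\<in>Basis. ((x - x0) \<bullet> b) * DF (x0 + t *\<^sub>R (x - x0)) b)"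
  proof (rule integral_cong)
    fix t :: real assume "t \<in> {0..1}"
    then interpret D: bounded_linear "DF (x0 + t *\<^sub>R (x - x0))"
      by (intro has_derivative_bounded_linear[OF DF] in_ball)
    show "DF (x0 + t *\<^sub>R (x - x0)) (x - x0) = (\<Sum>b\<in>Basis. ((x - x0) \<bullet> b) * DF (x0 + t *\<^sub>R (x - x0)) b)"
      by (subst (2) euclidean_representation[symmetric, of "x - x0"]) (simp only: D.sum D.scaleR real_scaleR_def)
  qed
  also have "\<dots> = (\<Sum>b\<in>Basis. integral {0..1} (\<lambda>t. ((x - x0) \<bullet> b) * DF (x0 + t *\<^sub>R (x - x0)) b))"
  proof (rule integral_sum[OF finite_Basis], rule integrable_continuous_interval)
    fix b :: 'a
    have "continuous_on {0..1} (\<lambda>t. DF (x0 + t *\<^sub>R (x - x0)) b)"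
      by (rule continuous_on_compose2[OF smooth_on_imp_continuous_on[OF smooth_DF]])
         (use in_ball in \<open>auto intro!: continuous_intros simp del: mem_ball\<close>)
    then show "continuous_on {0..1} (\<lambda>t. ((x - x0) \<bullet> b) * DF (x0 + t *\<^sub>R (x - x0)) b)"
      by (intro continuous_on_mult_left)
  qed
  also have "\<dots> = (\<Sum>b\<in>Basis. ((x - x0) \<bullet> b) * H b x)"
    by (simp add: H_def)
  finally show "F x = F x0 + (\<Sum>b\<in>Basis. ((x - x0) \<bullet> b) * H b x)" .
qed

section \<open>Smooth functions and tangent vectors on a manifold\<close>

context smooth_manifold
begin

lemma chart_inj: "(U, c) \<in> A \<Longrightarrow> inj_on c U"
  by (rule inj_on_inverseI[where g="inv_into U c"]) (use chart_homeo[of U c] in \<open>simp add: homeomorphism_def\<close>)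

lemma open_chart_image: "(U, c) \<in> A \<Longrightarrow> open W \<Longrightarrow> open (c ` (U \<inter> W))"
proof -
  assume c: "(U, c) \<in> A" and W: "open W"
  have "openin (top_of_set U) (U \<inter> W)" using W by blast
  with homeomorphism_imp_open_map[OF chart_homeo[OF c]]
  have "openin (top_of_set (c ` U)) (c ` (U \<inter> W))" by blast
  then show ?thesis using chart_open[OF c] openin_open_trans by blast
qed

lemma open_chart_vimage:
  assumes "(U, c) \<in> A" "open T"
  shows "open (U \<inter> c -` T)"
proof -
  have "continuous_on U c" using chart_homeo[OF assms(1)] by (simp add: homeomorphism_def)
  then show ?thesis
    using chart_open[OF assms(1)] assms(2) by (auto intro: continuous_open_preimage)
qed

lemma chart_at: obtains U c where "(U, c) \<in> A" "p \<in> U"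
proof -
  have "p \<in> (\<Union>(U, c)\<in>A. U)" using charts_cover by simp
  then show ?thesis using that by auto
qed

text \<open>Smooth transition maps carry smoothness from one chart around a point to every other, so
  one convenient chart and neighbourhood per point is enough.\<close>

lemma smooth_fun_onI:
  assumes "\<And>p. p \<in> W \<Longrightarrow> \<exists>U c W'. (U, c) \<in> A \<and> p \<in> U \<and> open W' \<and> p \<in> W' \<and>
      smooth_on (c ` (U \<inter> W')) (f \<circ> inv_into U c)"
  shows "smooth_fun_on A W f"
  unfolding smooth_fun_on_def
proof clarify
  fix V d assume d: "(V, d) \<in> A"
  show "smooth_on (d ` (V \<inter> W)) (f \<circ> inv_into V d)"
  proof (rule smooth_on_local)
    fix y assume "y \<in> d ` (V \<inter> W)"
    then obtain p where p: "y = d p" "p \<in> V" "p \<in> W" by blast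
    obtain U c W' where c: "(U, c) \<in> A" "p \<in> U" "open W'" "p \<in> W'"
      and f: "smooth_on (c ` (U \<inter> W')) (f \<circ> inv_into U c)"
      using assms[OF p(3)] by blast
    let ?T = "d ` (V \<inter> (U \<inter> W'))"
    have op: "open ?T" "open (c ` (U \<inter> W'))"
      using open_chart_image[OF d] open_chart_image[OF c(1)] chart_open[OF c(1)] c(3) by auto
    have "smooth_on ?T (\<lambda>x. (f \<circ> inv_into U c) ((c \<circ> inv_into V d) x))"
    proof (rule smooth_on_compose[OF op _ f])
      show "(c \<circ> inv_into V d) ` ?T \<subseteq> c ` (U \<inter> W')"
        using chart_inj[OF d] by (auto simp: inv_into_f_f)
      show "smooth_on ?T (c \<circ> inv_into V d)"
        by (rule smooth_on_subset[OF charts_compatible[OF d c(1)]]) auto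
    qed
    then have "smooth_on ?T (f \<circ> inv_into V d)"
      by (rule smooth_on_cong[OF op(1), rotated])
         (use chart_inj[OF d] chart_inj[OF c(1)] in \<open>auto simp: inv_into_f_f\<close>)
    moreover have "y \<in> ?T" using p c by auto
    ultimately show "\<exists>T. open T \<and> y \<in> T \<and> smooth_on T (f \<circ> inv_into V d)"
      using op(1) by blast
  qed
qed

lemma smooth_fun_onD:
  "smooth_fun_on A W f \<Longrightarrow> (U, c) \<in> A \<Longrightarrow> smooth_on (c ` (U \<inter> W)) (f \<circ> inv_into U c)"
  by (auto simp: smooth_fun_on_def)

lemma smooth_fun_on_subset: "smooth_fun_on A W f \<Longrightarrow> W' \<subseteq> W \<Longrightarrow> smooth_fun_on A W' f"
  unfolding smooth_fun_on_def by (blast intro: smooth_on_subset)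

lemma smooth_fun_on_cong:
  assumes "open W" "\<And>p. p \<in> W \<Longrightarrow> f p = h p" "smooth_fun_on A W f"
  shows "smooth_fun_on A W h"
  unfolding smooth_fun_on_def
proof clarify
  fix U c assume c: "(U, c) \<in> A"
  show "smooth_on (c ` (U \<inter> W)) (h \<circ> inv_into U c)"
    by (rule smooth_on_cong[OF open_chart_image[OF c assms(1)] _ smooth_fun_onD[OF assms(3) c]])
       (use assms(2) chart_inj[OF c] in \<open>auto simp: inv_into_f_f\<close>)
qed

lemma smooth_fun_on_const: "open W \<Longrightarrow> smooth_fun_on A W (\<lambda>p. a)"
  by (auto simp: smooth_fun_on_def o_def intro!: smooth_on_const open_chart_image)

lemma smooth_fun_on_add:
  "open W \<Longrightarrow> smooth_fun_on A W f \<Longrightarrow> smooth_fun_on A W h \<Longrightarrow> smooth_fun_on A W (\<lambda>p. f p + h p)"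
  by (auto simp: smooth_fun_on_def o_def intro!: smooth_on_add open_chart_image)

lemma smooth_fun_on_mult:
  "open W \<Longrightarrow> smooth_fun_on A W f \<Longrightarrow> smooth_fun_on A W h \<Longrightarrow> smooth_fun_on A W (\<lambda>p. f p * h p)"
  by (auto simp: smooth_fun_on_def o_def intro!: smooth_on_mult open_chart_image)

lemma smooth_fun_on_cmult: "open W \<Longrightarrow> smooth_fun_on A W f \<Longrightarrow> smooth_fun_on A W (\<lambda>p. a * f p)"
  by (intro smooth_fun_on_mult smooth_fun_on_const)

lemma smooth_fun_on_diff:
  assumes "open W" "smooth_fun_on A W f" "smooth_fun_on A W h"
  shows "smooth_fun_on A W (\<lambda>p. f p - h p)"
  using smooth_fun_on_add[OF assms(1,2) smooth_fun_on_cmult[OF assms(1,3), of "-1"]] by simp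

lemma smooth_atI: "open W \<Longrightarrow> p \<in> W \<Longrightarrow> smooth_fun_on A W f \<Longrightarrow> smooth_at A p f"
  by (auto simp: smooth_at_def)

lemma smooth_at2:
  assumes "smooth_at A p f" "smooth_at A p h"
  obtains W where "open W" "p \<in> W" "smooth_fun_on A W f" "smooth_fun_on A W h"
proof -
  obtain W1 W2 where "open W1" "p \<in> W1" "smooth_fun_on A W1 f" "open W2" "p \<in> W2" "smooth_fun_on A W2 h"
    using assms by (auto simp: smooth_at_def)
  then show ?thesis
    by (intro that[of "W1 \<inter> W2"]) (auto intro: smooth_fun_on_subset)
qed

lemma smooth_at_const: "smooth_at A p (\<lambda>q. a)"
  by (intro smooth_atI[of UNIV] smooth_fun_on_const) auto

lemma smooth_at_add: "smooth_at A p f \<Longrightarrow> smooth_at A p h \<Longrightarrow> smooth_at A p (\<lambda>q. f q + h q)"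
  by (erule (1) smooth_at2) (blast intro: smooth_atI smooth_fun_on_add)

lemma smooth_at_mult: "smooth_at A p f \<Longrightarrow> smooth_at A p h \<Longrightarrow> smooth_at A p (\<lambda>q. f q * h q)"
  by (erule (1) smooth_at2) (blast intro: smooth_atI smooth_fun_on_mult)

lemma smooth_at_diff: "smooth_at A p f \<Longrightarrow> smooth_at A p h \<Longrightarrow> smooth_at A p (\<lambda>q. f q - h q)"
  by (erule (1) smooth_at2) (blast intro: smooth_atI smooth_fun_on_diff)

lemma smooth_at_sum:
  "(\<And>i. i \<in> I \<Longrightarrow> smooth_at A p (f i)) \<Longrightarrow> smooth_at A p (\<lambda>q. \<Sum>i\<in>I. f i q)"
  by (induction I rule: infinite_finite_induct) (auto intro: smooth_at_const smooth_at_add)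

lemma smooth_at_cong:
  assumes "open W" "p \<in> W" "\<And>q. q \<in> W \<Longrightarrow> f q = h q" "smooth_at A p f"
  shows "smooth_at A p h"
proof -
  obtain W' where "open W'" "p \<in> W'" "smooth_fun_on A W' f" using assms(4) by (auto simp: smooth_at_def)
  then show ?thesis
    using assms(1-3)
    by (intro smooth_atI[of "W \<inter> W'"] smooth_fun_on_cong[of "W \<inter> W'" f h])
       (auto intro: smooth_fun_on_subset)
qed

lemma smooth_fun_on_imp_at: "smooth_fun_on A UNIV f \<Longrightarrow> smooth_at A p f"
  by (rule smooth_atI[of UNIV]) auto

section \<open>Tangent vectors as derivations\<close>

lemma
  assumes "v \<in> tangent_space A p" "smooth_at A p f" "smooth_at A p h"
  shows tangent_add: "v (\<lambda>q. f q + h q) = v f + v h"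
    and tangent_mult: "v (\<lambda>q. f q * h q) = v f * h p + f p * v h"
  using assms by (auto simp: tangent_space_def)

lemma tangent_cmult:
  "v \<in> tangent_space A p \<Longrightarrow> smooth_at A p f \<Longrightarrow> v (\<lambda>q. a * f q) = a * v f"
  by (auto simp: tangent_space_def)

lemma tangent_not_smooth: "v \<in> tangent_space A p \<Longrightarrow> \<not> smooth_at A p f \<Longrightarrow> v f = 0"
  by (auto simp: tangent_space_def)

lemma tangent_diff:
  assumes "v \<in> tangent_space A p" "smooth_at A p f" "smooth_at A p h"
  shows "v (\<lambda>q. f q - h q) = v f - v h"
  using tangent_add[OF assms(1,2) smooth_at_mult[OF smooth_at_const assms(3)], of "-1"]
    tangent_cmult[OF assms(1,3), of "-1"] by simp

lemma tangent_const:
  assumes "v \<in> tangent_space A p"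
  shows "v (\<lambda>q. a) = 0"
  using tangent_mult[OF assms smooth_at_const smooth_at_const, of 1 1]
    tangent_cmult[OF assms smooth_at_const, of a 1] by simp

lemma tangent_sum:
  assumes "v \<in> tangent_space A p" "\<And>i. i \<in> I \<Longrightarrow> smooth_at A p (f i)"
  shows "v (\<lambda>q. \<Sum>i\<in>I. f i q) = (\<Sum>i\<in>I. v (f i))"
  using assms(2)
proof (induction I rule: infinite_finite_induct)
  case (insert i I)
  then show ?case
    using tangent_add[OF assms(1), of "f i" "\<lambda>q. \<Sum>i\<in>I. f i q"] by (simp add: smooth_at_sum)
qed (simp_all add: tangent_const[OF assms(1)])

text \<open>If \<open>f - h\<close> vanishes near \<open>p\<close> it is unchanged by multiplication with the indicator function of
  the set where \<open>f \<noteq> h\<close>, which is smooth near \<open>p\<close>; so no bump functions are needed.\<close>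

lemma tangent_germ:
  assumes v: "v \<in> tangent_space A p" and W: "open W" "p \<in> W" "\<And>q. q \<in> W \<Longrightarrow> f q = h q"
  shows "v f = v h"
proof (cases "smooth_at A p f")
  case True
  have h: "smooth_at A p h" using smooth_at_cong[OF W True] .
  define d where "d q = f q - h q" for q
  define k where "k q = (if f q = h q then 0 else 1 :: real)" for q
  have d: "smooth_at A p d" unfolding d_def using True h by (rule smooth_at_diff)
  have k: "smooth_at A p k"
    by (rule smooth_at_cong[OF W(1,2) _ smooth_at_const[of p 0]]) (simp add: k_def W(3))
  have "(\<lambda>q. d q * k q) = d" by (auto simp: d_def k_def)
  then have "v d = 0"
    using tangent_mult[OF v d k] W(2,3) by (simp add: d_def k_def)
  then show ?thesis
    using tangent_diff[OF v True h] by (simp add: d_def[abs_def])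
next
  case False
  then have "\<not> smooth_at A p h"
    using smooth_at_cong[OF W(1,2), of h f] W(3) by auto
  with False show ?thesis using v by (simp add: tangent_not_smooth)
qed

lemma subspace_tangent_space: "subspace (tangent_space A p)"
  unfolding subspace_def
  by (auto simp: tangent_space_def plus_fun_def scaleR_fun_def zero_fun_def algebra_simps)

text \<open>Near \<open>p\<close>, Hadamard's lemma writes \<open>f\<close> as \<open>f p\<close>
  plus a sum of products of centred coordinates with smooth functions. A derivation kills the
  constant, and in each product Leibniz leaves only the term in which the coordinate is
  differentiated. Thus \<open>a b\<close> is the value of \<open>v\<close> on the coordinate
  \<open>b\<close>.\<close>

lemma tangent_partial:
  assumes v: "v \<in> tangent_space A p" and c: "(U, c) \<in> A" "p \<in> U"
  obtains a :: "'e \<Rightarrow> real" where "\<And>f. smooth_at A p f \<Longrightarrow>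
    v f = (\<Sum>b\<in>Basis. a b * frechet_derivative (f \<circ> inv_into U c) (at (c p)) b)"
proof
  \<comment> \<open>Coordinates centred at \<open>p\<close>; their vanishing there removes the other
    Leibniz term.\<close>
  define x where "x b q = (c q - c p) \<bullet> b" for b q
  have U: "open U" "open (c ` U)" using chart_open[OF c(1)] by auto
  have inv: "inv_into U c (c q) = q" if "q \<in> U" for q
    using that chart_inj[OF c(1)] by simp
  \<comment> \<open>Values of \<open>H (c q)\<close> for \<open>q\<close> far from \<open>p\<close>
    are arbitrary, but only the germ at \<open>p\<close> counts.\<close>
  have smooth_coord: "smooth_at A p (\<lambda>q. H (c q))" if "smooth_on (ball (c p) r) H" "r > 0" for H r
  proof (rule smooth_atI)
    let ?W = "U \<inter> c -` ball (c p) r"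
    show W: "open ?W" using open_chart_vimage[OF c(1)] by blast
    show "p \<in> ?W" using c(2) that by simp
    have "smooth_on (c ` (U \<inter> ?W)) ((\<lambda>q. H (c q)) \<circ> inv_into U c)"
      by (rule smooth_on_cong[OF open_chart_image[OF c(1) W] _ smooth_on_subset[OF that(1)]])
         (auto simp: inv)
    then show "smooth_fun_on A ?W (\<lambda>q. H (c q))"
      using c(1) W by (intro smooth_fun_onI) blast
  qed
  have x: "smooth_at A p (x b)" for b
  proof -
    have "smooth_on (ball (c p) 1) (\<lambda>y. (y - c p) \<bullet> b)"
      using smooth_on_add[OF open_ball smooth_on_bounded_linear[OF open_ball bounded_linear_inner_left]
        smooth_on_const[OF open_ball], of "c p" 1 b "- (c p \<bullet> b)"]
      by (simp add: inner_diff_left)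
    then show ?thesis unfolding x_def by (rule smooth_coord) simp
  qed
  fix f assume "smooth_at A p f"
  then obtain W where W: "open W" "p \<in> W" "smooth_fun_on A W f" by (auto simp: smooth_at_def)
  have "open (c ` (U \<inter> W))" "c p \<in> c ` (U \<inter> W)" using open_chart_image[OF c(1) W(1)] c W by auto
  then obtain r where r: "r > 0" "ball (c p) r \<subseteq> c ` (U \<inter> W)" by (meson open_contains_ball)
  have F: "smooth_on (ball (c p) r) (f \<circ> inv_into U c)"
    using smooth_on_subset[OF smooth_fun_onD[OF W(3) c(1)] r(2)] .
  obtain H where H: "\<And>b. smooth_on (ball (c p) r) (H b)"
    "\<And>y. y \<in> ball (c p) r \<Longrightarrow> (f \<circ> inv_into U c) y =
      (f \<circ> inv_into U c) (c p) + (\<Sum>b\<in>Basis. ((y - c p) \<bullet> b) * H b y)"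
    "\<And>b. H b (c p) = frechet_derivative (f \<circ> inv_into U c) (at (c p)) b"
    using hadamard[OF F r(1)] by blast
  have Hc: "smooth_at A p (\<lambda>q. H b (c q))" for b by (rule smooth_coord[OF H(1) r(1)])
  have "v f = v (\<lambda>q. f p + (\<Sum>b\<in>Basis. x b q * H b (c q)))"
  proof (rule tangent_germ[OF v])
    show "open (U \<inter> c -` ball (c p) r)" using open_chart_vimage[OF c(1)] by blast
    show "p \<in> U \<inter> c -` ball (c p) r" using c r by simp
    fix q assume "q \<in> U \<inter> c -` ball (c p) r"
    then show "f q = f p + (\<Sum>b\<in>Basis. x b q * H b (c q))"
      using H(2)[of "c q"] inv c(2) by (simp add: x_def)
  qed
  also have "\<dots> = (\<Sum>b\<in>Basis. v (\<lambda>q. x b q * H b (c q)))"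
    by (simp add: tangent_add[OF v] tangent_const[OF v] tangent_sum[OF v] smooth_at_const
        smooth_at_sum smooth_at_mult x Hc)
  also have "\<dots> = (\<Sum>b\<in>Basis. v (x b) * frechet_derivative (f \<circ> inv_into U c) (at (c p)) b)"
  proof -
    have "x b p = 0" for b by (simp add: x_def)
    then show ?thesis by (simp add: tangent_mult[OF v x Hc] H(3))
  qed
  finally show "v f = (\<Sum>b\<in>Basis. v (x b) * frechet_derivative (f \<circ> inv_into U c) (at (c p)) b)" .
qed

text \<open>The partial derivatives of one chart span; the span is taken in the ambient function
  space, so that a bound on independent sets follows directly.\<close>

lemma tangent_space_finite_dim:
  obtains B where "finite B" "tangent_space A p \<subseteq> span B"
proof -
  obtain U c where c: "(U, c) \<in> A" "p \<in> U" by (rule chart_at)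
  \<comment> \<open>Set to 0 on functions not smooth at \<open>p\<close>, as tangent vectors are, so
    that the expansion is an equality of functions.\<close>
  define D where "D b f = (if smooth_at A p f then frechet_derivative (f \<circ> inv_into U c) (at (c p)) b else 0)" for b f
  show ?thesis
  proof
    show "finite (D ` Basis)" by simp
    show "tangent_space A p \<subseteq> span (D ` Basis)"
    proof
      fix v assume v: "v \<in> tangent_space A p"
      obtain a where a: "\<And>f. smooth_at A p f \<Longrightarrow>
          v f = (\<Sum>b\<in>Basis. a b * frechet_derivative (f \<circ> inv_into U c) (at (c p)) b)"
        using tangent_partial[OF v c] by metis
      have "v f = (\<Sum>b\<in>Basis. a b *\<^sub>R D b) f" for f
      proof -
        have "(\<Sum>b\<in>I. a b *\<^sub>R D b) f = (\<Sum>b\<in>I. a b * D b f)" for I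
          by (induction I rule: infinite_finite_induct) (auto simp: scaleR_fun_def)
        then show ?thesis
          using a tangent_not_smooth[OF v] by (cases "smooth_at A p f") (auto simp: D_def)
      qed
      then have "v = (\<Sum>b\<in>Basis. a b *\<^sub>R D b)" by blast
      then show "v \<in> span (D ` Basis)"
        by (simp add: span_sum span_scale span_base)
    qed
  qed
qed

end

section \<open>Vector fields and diffeomorphisms\<close>

text \<open>Of the source only injective charts with open images are asked, rather than
  \<open>smooth_manifold\<close>, so that the lemma applies to \<open>prod_atlas A A\<close> and the
  multiplication map as well as to diffeomorphisms.\<close>

lemma smooth_fun_on_compose:
  assumes inj: "\<And>U c. (U, c) \<in> A \<Longrightarrow> inj_on c U"
    and op: "\<And>U c W. (U, c) \<in> A \<Longrightarrow> open W \<Longrightarrow> open (c ` (U \<inter> W))"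
    and B: "smooth_manifold B" and \<phi>: "smooth_map A B \<phi>"
    and W: "open W" and f: "smooth_fun_on B W f"
  shows "smooth_fun_on A (\<phi> -` W) (f \<circ> \<phi>)"
  unfolding smooth_fun_on_def
proof clarify
  interpret B: smooth_manifold B by (rule B)
  fix U c assume c: "(U, c) \<in> A"
  have cont: "continuous_on UNIV \<phi>" using \<phi> by (simp add: smooth_map_def)
  show "smooth_on (c ` (U \<inter> \<phi> -` W)) (f \<circ> \<phi> \<circ> inv_into U c)"
  proof (rule smooth_on_local)
    fix y assume "y \<in> c ` (U \<inter> \<phi> -` W)"
    then obtain p where p: "y = c p" "p \<in> U" "\<phi> p \<in> W" by blast
    obtain V d where d: "(V, d) \<in> B" "\<phi> p \<in> V" by (rule B.chart_at)
    let ?T = "c ` (U \<inter> \<phi> -` (V \<inter> W))"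
    have "open (\<phi> -` (V \<inter> W))"
      using cont W B.chart_open[OF d(1)] by (intro open_vimage) auto
    then have T: "open ?T" by (rule op[OF c])
    have "smooth_on (c ` (U \<inter> \<phi> -` V)) (d \<circ> \<phi> \<circ> inv_into U c)"
      using \<phi> c d(1) by (auto simp: smooth_map_def)
    then have \<phi>': "smooth_on ?T (d \<circ> \<phi> \<circ> inv_into U c)"
      by (rule smooth_on_subset) auto
    have "smooth_on ?T (\<lambda>x. (f \<circ> inv_into V d) ((d \<circ> \<phi> \<circ> inv_into U c) x))"
      by (rule smooth_on_compose[OF T B.open_chart_image[OF d(1) W] _ B.smooth_fun_onD[OF f d(1)] \<phi>'])
         (use inj[OF c] in auto)
    then have "smooth_on ?T (f \<circ> \<phi> \<circ> inv_into U c)"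
      by (rule smooth_on_cong[OF T, rotated]) (use inj[OF c] B.chart_inj[OF d(1)] in auto)
    moreover have "y \<in> ?T" using p d by auto
    ultimately show "\<exists>T. open T \<and> y \<in> T \<and> smooth_on T (f \<circ> \<phi> \<circ> inv_into U c)"
      using T by blast
  qed
qed

lemma linear_differential: "linear (differential B \<phi> p)"
  by (rule linearI) (auto simp: differential_def fun_eq_iff scaleR_fun_def)

section \<open>Vector fields and the Lie bracket\<close>

context smooth_manifold
begin

lemma vector_field_tangent: "X \<in> vector_fields A \<Longrightarrow> X p \<in> tangent_space A p"
  by (auto simp: vector_fields_def)

lemma vector_field_smooth:
  "X \<in> vector_fields A \<Longrightarrow> open W \<Longrightarrow> smooth_fun_on A W f \<Longrightarrow> smooth_fun_on A W (\<lambda>p. X p f)"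
  by (auto simp: vector_fields_def)

lemma vector_field_smooth_at:
  "X \<in> vector_fields A \<Longrightarrow> smooth_at A p f \<Longrightarrow> smooth_at A p (\<lambda>p. X p f)"
  unfolding smooth_at_def using vector_field_smooth by blast

lemma vector_field_add:
  "X \<in> vector_fields A \<Longrightarrow> Y \<in> vector_fields A \<Longrightarrow> X + Y \<in> vector_fields A"
  by (auto simp: vector_fields_def intro: subspace_add[OF subspace_tangent_space] smooth_fun_on_add)

lemma vector_field_fmult:
  assumes "X \<in> vector_fields A" "smooth_fun_on A UNIV f"
  shows "(\<lambda>p. f p *\<^sub>R X p) \<in> vector_fields A"
proof -
  have "smooth_fun_on A W (\<lambda>p. (f p *\<^sub>R X p) h)" if "open W" "smooth_fun_on A W h" for W h
    using smooth_fun_on_mult[OF that(1) smooth_fun_on_subset[OF assms(2)] vector_field_smooth[OF assms(1) that]]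
    by (simp add: scaleR_fun_def)
  then show ?thesis
    using vector_field_tangent[OF assms(1)]
    by (simp add: vector_fields_def subspace_scale[OF subspace_tangent_space])
qed

lemma vector_field_scaleR: "X \<in> vector_fields A \<Longrightarrow> a *\<^sub>R X \<in> vector_fields A"
  using vector_field_fmult[of X "\<lambda>_. a"] smooth_fun_on_const[of UNIV a] by (simp add: scaleR_fun_def)

lemma vector_field_zero: "0 \<in> vector_fields A"
  by (auto simp: vector_fields_def intro: subspace_0[OF subspace_tangent_space] smooth_fun_on_const)

lemma subspace_vector_fields: "subspace (vector_fields A)"
  by (auto simp: subspace_def vector_field_add vector_field_scaleR vector_field_zero)

lemma vf_bracket_apply: "smooth_at A p f \<Longrightarrow> vf_bracket A X Y p f = X p (\<lambda>q. Y q f) - Y p (\<lambda>q. X q f)"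
  by (simp add: vf_bracket_def)

text \<open>The second-order operator \<open>f \<mapsto> X (Y f)\<close> violates the Leibniz rule
  by \<open>X f * Y h + Y f * X h\<close>. This defect is symmetric in \<open>X\<close> and
  \<open>Y\<close>, so it cancels in the commutator.\<close>

lemma vf_bracket_tangent:
  assumes X: "X \<in> vector_fields A" and Y: "Y \<in> vector_fields A"
  shows "vf_bracket A X Y p \<in> tangent_space A p"
proof -
  have add: "X p (\<lambda>q. Y q (\<lambda>r. f r + h r)) = X p (\<lambda>q. Y q f) + X p (\<lambda>q. Y q h)"
    and mult: "X p (\<lambda>q. Y q (\<lambda>r. f r * h r)) =
      X p (\<lambda>q. Y q f) * h p + Y p f * X p h + X p f * Y p h + f p * X p (\<lambda>q. Y q h)"
    if X: "X \<in> vector_fields A" and Y: "Y \<in> vector_fields A"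
      and f: "smooth_at A p f" and h: "smooth_at A p h" for X Y f h
  proof -
    note Xp = vector_field_tangent[OF X, of p] and Yq = vector_field_tangent[OF Y]
    obtain W where W: "open W" "p \<in> W" "smooth_fun_on A W f" "smooth_fun_on A W h"
      using smooth_at2[OF f h] .
    have at: "smooth_at A q f" "smooth_at A q h" if "q \<in> W" for q
      using W that by (auto intro: smooth_atI)
    have Yf: "smooth_at A p (\<lambda>q. Y q f)" "smooth_at A p (\<lambda>q. Y q h)"
      using vector_field_smooth_at[OF Y] f h by auto
    \<comment> \<open>The rule for \<open>Y\<close> is available only at points where
      \<open>f\<close> and \<open>h\<close> are smooth, so the argument of \<open>X p\<close> is
      rewritten as a germ at \<open>p\<close>.\<close>
    have "X p (\<lambda>q. Y q (\<lambda>r. f r + h r)) = X p (\<lambda>q. Y q f + Y q h)"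
      by (rule tangent_germ[OF Xp W(1,2)]) (use tangent_add[OF Yq at] in simp)
    then show "X p (\<lambda>q. Y q (\<lambda>r. f r + h r)) = X p (\<lambda>q. Y q f) + X p (\<lambda>q. Y q h)"
      by (simp add: tangent_add[OF Xp Yf])
    have "X p (\<lambda>q. Y q (\<lambda>r. f r * h r)) = X p (\<lambda>q. Y q f * h q + f q * Y q h)"
      by (rule tangent_germ[OF Xp W(1,2)]) (use tangent_mult[OF Yq at] in simp)
    also have "\<dots> = X p (\<lambda>q. Y q f) * h p + Y p f * X p h + (X p f * Y p h + f p * X p (\<lambda>q. Y q h))"
      using Yf f h by (simp add: tangent_add[OF Xp] tangent_mult[OF Xp] smooth_at_mult)
    finally show "X p (\<lambda>q. Y q (\<lambda>r. f r * h r)) =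
      X p (\<lambda>q. Y q f) * h p + Y p f * X p h + X p f * Y p h + f p * X p (\<lambda>q. Y q h)" by simp
  qed
  have scale: "X p (\<lambda>q. Y q (\<lambda>r. a * f r)) = a * X p (\<lambda>q. Y q f)"
    if X: "X \<in> vector_fields A" and Y: "Y \<in> vector_fields A" and f: "smooth_at A p f" for X Y f a
    using mult[OF X Y smooth_at_const f, of a]
      tangent_const[OF vector_field_tangent[OF Y]] tangent_const[OF vector_field_tangent[OF X]]
    by simp
  let ?b = "vf_bracket A X Y p"
  have "?b (\<lambda>q. f q + h q) = ?b f + ?b h" "?b (\<lambda>q. f q * h q) = ?b f * h p + f p * ?b h"
    if f: "smooth_at A p f" and h: "smooth_at A p h" for f h
    unfolding vf_bracket_apply[OF f] vf_bracket_apply[OF h]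
      vf_bracket_apply[OF smooth_at_add[OF f h]] vf_bracket_apply[OF smooth_at_mult[OF f h]]
      add[OF X Y f h] add[OF Y X f h] mult[OF X Y f h] mult[OF Y X f h]
    by algebra+
  moreover have "?b (\<lambda>q. a * f q) = a * ?b f" if f: "smooth_at A p f" for f a
    unfolding vf_bracket_apply[OF f] vf_bracket_apply[OF smooth_at_mult[OF smooth_at_const f]]
      scale[OF X Y f] scale[OF Y X f]
    by algebra
  moreover have "?b f = 0" if "\<not> smooth_at A p f" for f
    using that by (simp add: vf_bracket_def)
  ultimately show ?thesis by (simp add: tangent_space_def)
qed

lemma vf_bracket_vector_field:
  assumes X: "X \<in> vector_fields A" and Y: "Y \<in> vector_fields A"
  shows "vf_bracket A X Y \<in> vector_fields A"
proof -
  have "smooth_fun_on A W (\<lambda>p. vf_bracket A X Y p f)" if "open W" "smooth_fun_on A W f" for W f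
  proof (rule smooth_fun_on_cong[OF that(1)])
    show "smooth_fun_on A W (\<lambda>p. X p (\<lambda>q. Y q f) - Y p (\<lambda>q. X q f))"
      using that by (simp add: smooth_fun_on_diff vector_field_smooth X Y)
    show "X p (\<lambda>q. Y q f) - Y p (\<lambda>q. X q f) = vf_bracket A X Y p f" if "p \<in> W" for p
      by (rule vf_bracket_apply[symmetric, OF smooth_atI]) fact+
  qed
  then show ?thesis
    using vf_bracket_tangent[OF X Y] by (auto simp: vector_fields_def)
qed

lemma vf_bracket_antisym: "vf_bracket A X Y = - vf_bracket A Y X"
  by (auto simp: vf_bracket_def fun_eq_iff)

lemma vf_bracket_add_right:
  assumes X: "X \<in> vector_fields A" and Y: "Y \<in> vector_fields A" and Z: "Z \<in> vector_fields A"
  shows "vf_bracket A X (Y + Z) = vf_bracket A X Y + vf_bracket A X Z"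
proof (intro ext)
  fix p f
  show "vf_bracket A X (Y + Z) p f = (vf_bracket A X Y + vf_bracket A X Z) p f"
  proof (cases "smooth_at A p f")
    case True
    then show ?thesis
      using tangent_add[OF vector_field_tangent[OF X] vector_field_smooth_at[OF Y True]
          vector_field_smooth_at[OF Z True]]
      by (simp add: vf_bracket_apply)
  qed (simp add: vf_bracket_def)
qed

lemma vf_bracket_add_left:
  assumes "X \<in> vector_fields A" "Y \<in> vector_fields A" "Z \<in> vector_fields A"
  shows "vf_bracket A (X + Y) Z = vf_bracket A X Z + vf_bracket A Y Z"
  using vf_bracket_add_right[OF assms(3,1,2)] vf_bracket_antisym[of _ Z] by simp

lemma vf_bracket_fmult_right:
  assumes X: "X \<in> vector_fields A" and Y: "Y \<in> vector_fields A" and f: "smooth_fun_on A UNIV f"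
  shows "vf_bracket A X (\<lambda>p. f p *\<^sub>R Y p) = (\<lambda>p. f p *\<^sub>R vf_bracket A X Y p + X p f *\<^sub>R Y p)"
proof (intro ext)
  fix p h
  show "vf_bracket A X (\<lambda>p. f p *\<^sub>R Y p) p h = (f p *\<^sub>R vf_bracket A X Y p + X p f *\<^sub>R Y p) h"
  proof (cases "smooth_at A p h")
    case True
    then show ?thesis
      using tangent_mult[OF vector_field_tangent[OF X] smooth_fun_on_imp_at[OF f]
          vector_field_smooth_at[OF Y True]]
      by (simp add: vf_bracket_apply scaleR_fun_def algebra_simps)
  next
    case False
    then show ?thesis
      using tangent_not_smooth[OF vector_field_tangent[OF Y] False]
      by (simp add: vf_bracket_def scaleR_fun_def)
  qed
qed

lemma vf_bracket_fmult_left: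
  assumes "X \<in> vector_fields A" "Y \<in> vector_fields A" "smooth_fun_on A UNIV f"
  shows "vf_bracket A (\<lambda>p. f p *\<^sub>R X p) Y = (\<lambda>p. f p *\<^sub>R vf_bracket A X Y p - Y p f *\<^sub>R X p)"
  using vf_bracket_fmult_right[OF assms(2,1,3)] vf_bracket_antisym[of _ Y]
  by (simp add: fun_eq_iff scaleR_fun_def)

end

section \<open>Push-forward of vector fields\<close>

locale manifold_diffeo = smooth_manifold A
  for A :: "('m::{t2_space, second_countable_topology}, 'e::euclidean_space) chart set" +
  fixes \<phi> :: "'m \<Rightarrow> 'm"
  assumes diffeo: "diffeomorphism A A \<phi>"
begin

abbreviation \<psi> :: "'m \<Rightarrow> 'm" where "\<psi> \<equiv> inv_into UNIV \<phi>"

lemma inverse_simps [simp]: "\<psi> (\<phi> p) = p" "\<phi> (\<psi> p) = p"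
  using diffeo by (auto simp: diffeomorphism_def bij_def surj_f_inv_f)

lemma smooth_fun_on_diffeo:
  assumes "open W" "smooth_fun_on A W f"
  shows "smooth_fun_on A (\<phi> -` W) (f \<circ> \<phi>)" "smooth_fun_on A (\<psi> -` W) (f \<circ> \<psi>)"
  using diffeo unfolding diffeomorphism_def
  by (auto intro!: smooth_fun_on_compose chart_inj open_chart_image smooth_manifold_axioms assms)

lemma open_vimage_diffeo: "open W \<Longrightarrow> open (\<phi> -` W)" "open W \<Longrightarrow> open (\<psi> -` W)"
  using diffeo by (auto simp: diffeomorphism_def smooth_map_def intro: open_vimage)

lemma smooth_at_diffeo: "smooth_at A p (f \<circ> \<phi>) \<longleftrightarrow> smooth_at A (\<phi> p) f"
proof
  assume "smooth_at A (\<phi> p) f"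
  then obtain W where "open W" "\<phi> p \<in> W" "smooth_fun_on A W f" by (auto simp: smooth_at_def)
  then show "smooth_at A p (f \<circ> \<phi>)"
    using smooth_fun_on_diffeo open_vimage_diffeo by (intro smooth_atI[of "\<phi> -` W"]) auto
next
  assume "smooth_at A p (f \<circ> \<phi>)"
  then obtain W where W: "open W" "p \<in> W" "smooth_fun_on A W (f \<circ> \<phi>)" by (auto simp: smooth_at_def)
  have "f \<circ> \<phi> \<circ> \<psi> = f" by auto
  with W show "smooth_at A (\<phi> p) f"
    using smooth_fun_on_diffeo(2)[OF W(1,3)] open_vimage_diffeo by (intro smooth_atI[of "\<psi> -` W"]) auto
qed

text \<open>If \<open>f\<close> is not smooth at \<open>\<phi> p\<close>, then
  \<open>f \<circ> \<phi>\<close> is not smooth at \<open>p\<close> and \<open>v\<close> already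
  vanishes on it, so the case distinction in \<open>differential\<close> disappears for a
  diffeomorphism.\<close>

lemma differential_apply:
  "v \<in> tangent_space A p \<Longrightarrow> differential A \<phi> p v f = v (f \<circ> \<phi>)"
  by (auto simp: differential_def smooth_at_diffeo tangent_not_smooth)

lemma differential_tangent:
  assumes v: "v \<in> tangent_space A p"
  shows "differential A \<phi> p v \<in> tangent_space A (\<phi> p)"
  unfolding tangent_space_def
  using tangent_add[OF v] tangent_mult[OF v] tangent_cmult[OF v] tangent_not_smooth[OF v]
  by (auto simp: differential_apply[OF v] smooth_at_diffeo[symmetric] o_def)

definition push :: "('m \<Rightarrow> 'm tangent) \<Rightarrow> 'm \<Rightarrow> 'm tangent"
  where "push X q = differential A \<phi> (\<psi> q) (X (\<psi> q))"

lemma push_at: "push X (\<phi> p) = differential A \<phi> p (X p)"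
  by (simp add: push_def)

lemma push_apply: "X \<in> vector_fields A \<Longrightarrow> push X (\<phi> p) f = X p (f \<circ> \<phi>)"
  by (simp add: push_at differential_apply vector_field_tangent)

lemma push_comp: "X \<in> vector_fields A \<Longrightarrow> (\<lambda>q. push X q f) \<circ> \<phi> = (\<lambda>p. X p (f \<circ> \<phi>))"
  by (auto simp: push_apply)

lemma push_vector_field:
  assumes X: "X \<in> vector_fields A"
  shows "push X \<in> vector_fields A"
proof -
  have "push X q \<in> tangent_space A q" for q
    using differential_tangent[OF vector_field_tangent[OF X], of "\<psi> q"] by (simp add: push_def)
  moreover have "smooth_fun_on A W (\<lambda>q. push X q f)" if W: "open W" "smooth_fun_on A W f" for W f
  proof -
    have "smooth_fun_on A (\<phi> -` W) (\<lambda>p. X p (f \<circ> \<phi>))"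
      by (rule vector_field_smooth[OF X open_vimage_diffeo(1)[OF W(1)] smooth_fun_on_diffeo(1)[OF W]])
    from smooth_fun_on_diffeo(2)[OF open_vimage_diffeo(1)[OF W(1)] this] have "smooth_fun_on A (\<psi> -` \<phi> -` W) ((\<lambda>p. X p (f \<circ> \<phi>)) \<circ> \<psi>)" .
    moreover have "(\<lambda>p. X p (f \<circ> \<phi>)) \<circ> \<psi> = (\<lambda>q. push X q f)"
      using push_apply[OF X, of "\<psi> q" f for q] by auto
    moreover have "\<psi> -` \<phi> -` W = W" by auto
    ultimately show ?thesis by simp
  qed
  ultimately show ?thesis by (auto simp: vector_fields_def)
qed

lemma push_bracket:
  assumes X: "X \<in> vector_fields A" and Y: "Y \<in> vector_fields A"
  shows "push (vf_bracket A X Y) = vf_bracket A (push X) (push Y)"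
proof (intro ext)
  fix q f
  obtain p where q: "q = \<phi> p" using inverse_simps(2) by metis
  show "push (vf_bracket A X Y) q f = vf_bracket A (push X) (push Y) q f"
  proof (cases "smooth_at A q f")
    case True
    then have "smooth_at A p (f \<circ> \<phi>)" by (simp add: smooth_at_diffeo q)
    then show ?thesis using True X Y
      by (simp add: q push_apply vf_bracket_vector_field vf_bracket_apply push_comp)
  next
    case False
    then have "\<not> smooth_at A p (f \<circ> \<phi>)" by (simp add: smooth_at_diffeo q)
    then show ?thesis using False X Y
      by (simp add: q push_apply vf_bracket_vector_field) (simp add: vf_bracket_def)
  qed
qed

end

section \<open>Levi-Civita connection and curvature\<close>

lemma sum_fun_apply: "(\<Sum>i\<in>I. f i) x = (\<Sum>i\<in>I. f i x)"
  by (induction I rule: infinite_finite_induct) auto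

lemma scaleR_fun_apply: "(a *\<^sub>R f) x = a *\<^sub>R f x"
  by (simp add: scaleR_fun_def)

section \<open>Pseudo-Riemannian metrics and the Koszul formula\<close>

locale pseudo_riemannian_manifold = smooth_manifold A
  for A :: "('m::{t2_space, second_countable_topology}, 'e::euclidean_space) chart set" +
  fixes g :: "'m metric"
  assumes metric: "pseudo_riemannian A g"
begin

lemma metric_sym:
  "u \<in> tangent_space A p \<Longrightarrow> v \<in> tangent_space A p \<Longrightarrow> g p u v = g p v u"
  using metric by (simp add: pseudo_riemannian_def)

lemma metric_scale_add:
  "u \<in> tangent_space A p \<Longrightarrow> v \<in> tangent_space A p \<Longrightarrow> w \<in> tangent_space A p \<Longrightarrow>
    g p (a *\<^sub>R u + v) w = a * g p u w + g p v w"
  using metric by (simp add: pseudo_riemannian_def)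

lemma metric_add_left:
  "u \<in> tangent_space A p \<Longrightarrow> v \<in> tangent_space A p \<Longrightarrow> w \<in> tangent_space A p \<Longrightarrow>
    g p (u + v) w = g p u w + g p v w"
  using metric_scale_add[of u p v w 1] by simp

lemma metric_zero_left: "w \<in> tangent_space A p \<Longrightarrow> g p 0 w = 0"
  using metric_add_left[of 0 p 0 w] subspace_0[OF subspace_tangent_space[of p]] by simp

lemma metric_scale_left:
  "u \<in> tangent_space A p \<Longrightarrow> w \<in> tangent_space A p \<Longrightarrow> g p (a *\<^sub>R u) w = a * g p u w"
  using metric_scale_add[of u p 0 w a] subspace_0[OF subspace_tangent_space[of p]]
  by (simp add: metric_zero_left)

lemma metric_diff_left:
  "u \<in> tangent_space A p \<Longrightarrow> v \<in> tangent_space A p \<Longrightarrow> w \<in> tangent_space A p \<Longrightarrow>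
    g p (u - v) w = g p u w - g p v w"
  using metric_scale_add[of v p u w "-1"] by (simp add: algebra_simps)

lemma metric_sum_left:
  assumes "\<And>i. i \<in> I \<Longrightarrow> u i \<in> tangent_space A p" "w \<in> tangent_space A p"
  shows "g p (\<Sum>i\<in>I. u i) w = (\<Sum>i\<in>I. g p (u i) w)"
  using assms(1)
proof (induction I rule: infinite_finite_induct)
  case (insert i I)
  then have "g p (u i + sum u I) w = g p (u i) w + g p (sum u I) w"
    using assms(2) by (intro metric_add_left subspace_sum[OF subspace_tangent_space]) auto
  then have "g p (sum u (insert i I)) w = g p (u i) w + g p (sum u I) w"
    by (subst sum.insert[OF insert.hyps])
  moreover have "g p (sum u I) w = (\<Sum>i\<in>I. g p (u i) w)" using insert by auto
  ultimately show ?case by (simp only: sum.insert[OF insert.hyps])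
qed (simp_all add: metric_zero_left assms(2))

lemma metric_nondegenerate:
  assumes "u \<in> tangent_space A p" "v \<in> tangent_space A p"
    and "\<And>w. w \<in> tangent_space A p \<Longrightarrow> g p u w = g p v w"
  shows "u = v"
proof -
  have "u - v \<in> tangent_space A p" using assms subspace_diff[OF subspace_tangent_space] by blast
  moreover have "g p (u - v) w = 0" if "w \<in> tangent_space A p" for w
    using that assms by (simp add: metric_diff_left)
  moreover have "nondegenerate_on (g p) (tangent_space A p)"
    using metric by (simp add: pseudo_riemannian_def)
  ultimately have "u - v = 0" unfolding nondegenerate_on_def by blast
  then show ?thesis by simp
qed

definition ip :: "('m \<Rightarrow> 'm tangent) \<Rightarrow> ('m \<Rightarrow> 'm tangent) \<Rightarrow> 'm \<Rightarrow> real"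
  where "ip X Y p = g p (X p) (Y p)"

lemma ip_smooth:
  "X \<in> vector_fields A \<Longrightarrow> Y \<in> vector_fields A \<Longrightarrow> smooth_fun_on A UNIV (ip X Y)"
  unfolding ip_def[abs_def] using metric by (simp add: pseudo_riemannian_def)

lemma ip_sym: "X \<in> vector_fields A \<Longrightarrow> Y \<in> vector_fields A \<Longrightarrow> ip X Y = ip Y X"
  by (simp add: ip_def fun_eq_iff metric_sym vector_field_tangent)

lemma ip_add_left:
  "X \<in> vector_fields A \<Longrightarrow> Y \<in> vector_fields A \<Longrightarrow> Z \<in> vector_fields A \<Longrightarrow>
    ip (X + Y) Z = (\<lambda>p. ip X Z p + ip Y Z p)"
  by (simp add: ip_def fun_eq_iff metric_add_left vector_field_tangent)

lemma ip_add_right: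
  "X \<in> vector_fields A \<Longrightarrow> Y \<in> vector_fields A \<Longrightarrow> Z \<in> vector_fields A \<Longrightarrow>
    ip Z (X + Y) = (\<lambda>p. ip Z X p + ip Z Y p)"
  using ip_add_left[of X Y Z] by (simp add: ip_sym vector_field_add)

lemma ip_fmult_left:
  "X \<in> vector_fields A \<Longrightarrow> Y \<in> vector_fields A \<Longrightarrow> ip (\<lambda>p. f p *\<^sub>R X p) Y = (\<lambda>p. f p * ip X Y p)"
  by (simp add: ip_def fun_eq_iff metric_scale_left vector_field_tangent)

lemma ip_fmult_right:
  assumes "X \<in> vector_fields A" "Y \<in> vector_fields A"
  shows "ip Y (\<lambda>p. f p *\<^sub>R X p) = (\<lambda>p. f p * ip Y X p)"
proof
  fix p
  have "g p (Y p) (f p *\<^sub>R X p) = g p (f p *\<^sub>R X p) (Y p)"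
    using assms by (intro metric_sym subspace_scale[OF subspace_tangent_space] vector_field_tangent)
  then show "ip Y (\<lambda>p. f p *\<^sub>R X p) p = f p * ip Y X p"
    using assms by (simp add: ip_def metric_scale_left vector_field_tangent metric_sym[of "X p"])
qed

lemma ip_diff_left:
  "X \<in> vector_fields A \<Longrightarrow> Y \<in> vector_fields A \<Longrightarrow> Z \<in> vector_fields A \<Longrightarrow>
    ip (X - Y) Z = (\<lambda>p. ip X Z p - ip Y Z p)"
  by (simp add: ip_def fun_eq_iff metric_diff_left vector_field_tangent)

text \<open>The right-hand side of the Koszul formula for \<open>2 \<langle>\<nabla>\<^sub>X Y, Z\<rangle>\<close>.\<close>

definition koszul where
  "koszul X Y Z p = X p (ip Y Z) + Y p (ip X Z) - Z p (ip X Y)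
    + ip (vf_bracket A X Y) Z p - ip (vf_bracket A X Z) Y p - ip (vf_bracket A Y Z) X p"

lemma vector_field_fadd:
  "X \<in> vector_fields A \<Longrightarrow> smooth_fun_on A UNIV f \<Longrightarrow> smooth_fun_on A UNIV h \<Longrightarrow>
    X p (\<lambda>q. f q + h q) = X p f + X p h"
  by (rule tangent_add[OF vector_field_tangent[of X p]]) (auto intro: smooth_fun_on_imp_at)

lemma vector_field_leibniz:
  "X \<in> vector_fields A \<Longrightarrow> smooth_fun_on A UNIV f \<Longrightarrow> smooth_fun_on A UNIV h \<Longrightarrow>
    X p (\<lambda>q. f q * h q) = X p f * h p + f p * X p h"
  by (rule tangent_mult[OF vector_field_tangent[of X p]]) (auto intro: smooth_fun_on_imp_at)

lemma koszul_smooth: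
  assumes "X \<in> vector_fields A" "Y \<in> vector_fields A" "Z \<in> vector_fields A"
  shows "smooth_fun_on A UNIV (koszul X Y Z)"
proof -
  have "smooth_fun_on A UNIV (\<lambda>p. X p (ip Y Z))"
    if "X \<in> vector_fields A" "Y \<in> vector_fields A" "Z \<in> vector_fields A" for X Y Z
    using vector_field_smooth[OF that(1) open_UNIV ip_smooth[OF that(2,3)]] .
  then show ?thesis
    unfolding koszul_def[abs_def] using assms
    by (intro smooth_fun_on_add smooth_fun_on_diff open_UNIV ip_smooth vf_bracket_vector_field)
qed

lemma koszul_add:
  assumes V: "X \<in> vector_fields A" "Y \<in> vector_fields A" "Z \<in> vector_fields A" "W \<in> vector_fields A"
  shows "koszul (X + W) Y Z p = koszul X Y Z p + koszul W Y Z p"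
    and "koszul X (Y + W) Z p = koszul X Y Z p + koszul X W Z p"
    and "koszul X Y (Z + W) p = koszul X Y Z p + koszul X Y W p"
  using V by (simp_all add: koszul_def ip_add_left ip_add_right vf_bracket_add_left
      vf_bracket_add_right vf_bracket_vector_field vector_field_fadd ip_smooth)

lemma ip_bracket_fmult:
  assumes V: "X \<in> vector_fields A" "Y \<in> vector_fields A" "Z \<in> vector_fields A"
    and f: "smooth_fun_on A UNIV f"
  shows "ip (vf_bracket A (\<lambda>p. f p *\<^sub>R X p) Y) Z p = f p * ip (vf_bracket A X Y) Z p - Y p f * ip X Z p"
    and "ip (vf_bracket A Y (\<lambda>p. f p *\<^sub>R X p)) Z p = f p * ip (vf_bracket A Y X) Z p + Y p f * ip X Z p"
  using V f
  by (simp_all add: ip_def vf_bracket_fmult_left vf_bracket_fmult_right metric_diff_left metric_add_left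
      metric_scale_left vector_field_tangent vf_bracket_tangent subspace_scale[OF subspace_tangent_space])

text \<open>The derivatives of \<open>f\<close> coming from the metric terms cancel those coming
  from the brackets, except in the middle slot, where the two copies of \<open>X f\<close> add up.
  This is exactly what half of \<open>koszul\<close> needs in order to define a connection.\<close>

lemma koszul_fmult:
  assumes V: "X \<in> vector_fields A" "Y \<in> vector_fields A" "Z \<in> vector_fields A"
    and f: "smooth_fun_on A UNIV f"
  shows "koszul (\<lambda>p. f p *\<^sub>R X p) Y Z p = f p * koszul X Y Z p"
    and "koszul X (\<lambda>p. f p *\<^sub>R Y p) Z p = f p * koszul X Y Z p + 2 * X p f * ip Y Z p"
    and "koszul X Y (\<lambda>p. f p *\<^sub>R Z p) p = f p * koszul X Y Z p"
proof -
  note simps = koszul_def ip_bracket_fmult ip_fmult_left ip_fmult_right vf_bracket_vector_field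
    vector_field_leibniz ip_smooth scaleR_fun_apply
  note sy = ip_sym[OF V(2,1)] ip_sym[OF V(3,1)] ip_sym[OF V(3,2)]
  show "koszul (\<lambda>p. f p *\<^sub>R X p) Y Z p = f p * koszul X Y Z p"
    using V f by (simp add: simps sy) (simp add: algebra_simps)
  show "koszul X (\<lambda>p. f p *\<^sub>R Y p) Z p = f p * koszul X Y Z p + 2 * X p f * ip Y Z p"
    using V f by (simp add: simps sy) (simp add: algebra_simps)
  show "koszul X Y (\<lambda>p. f p *\<^sub>R Z p) p = f p * koszul X Y Z p"
    using V f by (simp add: simps sy) (simp add: algebra_simps)
qed

text \<open>Metric compatibility rewrites the three derivatives and vanishing torsion the three
  brackets; all but two equal terms cancel. Since the right-hand side does not mention
  \<open>D\<close>, this pins down whichever connection \<open>levi_civita\<close> picks, on smooth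
  fields.\<close>

lemma levi_civita_koszul:
  assumes D: "is_levi_civita A g D"
    and V: "X \<in> vector_fields A" "Y \<in> vector_fields A" "Z \<in> vector_fields A"
  shows "2 * ip (D X Y) Z p = koszul X Y Z p"
proof -
  have vf: "D X Y \<in> vector_fields A" if "X \<in> vector_fields A" "Y \<in> vector_fields A" for X Y
    using D that by (simp add: is_levi_civita_def affine_connection_def)
  have br: "vf_bracket A X Y = D X Y - D Y X" if "X \<in> vector_fields A" "Y \<in> vector_fields A" for X Y
    using D that by (simp add: is_levi_civita_def)
  have compat: "X p (ip Y Z) = ip (D X Y) Z p + ip (D X Z) Y p"
    if "X \<in> vector_fields A" "Y \<in> vector_fields A" "Z \<in> vector_fields A" for X Y Z
  proof -
    have "X p (\<lambda>q. g q (Y q) (Z q)) = g p (D X Y p) (Z p) + g p (Y p) (D X Z p)"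
      using D that unfolding is_levi_civita_def by blast
    then show ?thesis
      using metric_sym[OF vector_field_tangent[OF that(2)] vector_field_tangent[OF vf[OF that(1,3)]]]
      by (simp add: ip_def[abs_def])
  qed
  show ?thesis
    unfolding koszul_def using V by (simp add: br compat ip_diff_left vf)
qed

end

text \<open>A global frame \<open>E\<close> with its dual frame \<open>F\<close>, encoded by the
  expansion formula. The coefficients of a field are then globally smooth functions, which turns
  linearity over functions into dependence on pointwise values.\<close>

locale framed_manifold = pseudo_riemannian_manifold A g
  for A :: "('m::{t2_space, second_countable_topology}, 'e::euclidean_space) chart set" and g +
  fixes I :: "'i set" and E F :: "'i \<Rightarrow> 'm \<Rightarrow> 'm tangent"
  assumes finite_I: "finite I"
    and frame: "i \<in> I \<Longrightarrow> E i \<in> vector_fields A" "i \<in> I \<Longrightarrow> F i \<in> vector_fields A"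
    and frame_expand: "v \<in> tangent_space A p \<Longrightarrow> v = (\<Sum>i\<in>I. g p v (F i p) *\<^sub>R E i p)"
begin

text \<open>The expansion says that the sum of \<open>E i \<otimes> F i\<close> is the inverse
  metric, which is symmetric. Concretely, pair with \<open>w\<close> and expand \<open>w\<close>
  instead of \<open>v\<close>.\<close>

lemma frame_swap: "framed_manifold A g I F E"
proof
  fix v p assume v: "v \<in> tangent_space A p"
  have F: "F i p \<in> tangent_space A p" and E: "E i p \<in> tangent_space A p" if "i \<in> I" for i
    using frame that by (auto intro: vector_field_tangent)
  have sum: "(\<Sum>i\<in>I. g p v (E i p) *\<^sub>R F i p) \<in> tangent_space A p"
    using F by (intro subspace_sum subspace_scale subspace_tangent_space)
  show "v = (\<Sum>i\<in>I. g p v (E i p) *\<^sub>R F i p)"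
  proof (rule metric_nondegenerate[OF v sum])
    fix w assume w: "w \<in> tangent_space A p"
    have "g p (\<Sum>i\<in>I. g p w (F i p) *\<^sub>R E i p) v = (\<Sum>i\<in>I. g p w (F i p) * g p (E i p) v)"
      using E v by (subst metric_sum_left) (auto simp: metric_scale_left subspace_scale[OF subspace_tangent_space])
    then have "g p w v = (\<Sum>i\<in>I. g p w (F i p) * g p (E i p) v)"
      by (simp flip: frame_expand[OF w])
    also have "\<dots> = (\<Sum>i\<in>I. g p (g p v (E i p) *\<^sub>R F i p) w)"
      using E F v w by (intro sum.cong) (auto simp: metric_scale_left metric_sym)
    also have "\<dots> = g p (\<Sum>i\<in>I. g p v (E i p) *\<^sub>R F i p) w"
      using F w by (subst metric_sum_left) (auto intro: subspace_scale[OF subspace_tangent_space])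
    finally show "g p v w = g p (\<Sum>i\<in>I. g p v (E i p) *\<^sub>R F i p) w"
      using v w by (simp add: metric_sym)
  qed
qed (use finite_I frame in auto)

text \<open>Here \<open>T\<close> is an operator already evaluated at \<open>p\<close>, so a
  function factor comes out as the number \<open>f p\<close>. Expanding \<open>X\<close> globally in
  the frame shows that \<open>T X\<close> depends on \<open>X\<close> only through
  \<open>X p\<close>.\<close>

lemma tensorial_expand:
  fixes T :: "('m \<Rightarrow> 'm tangent) \<Rightarrow> 'v::real_vector"
  assumes add: "\<And>X Y. X \<in> vector_fields A \<Longrightarrow> Y \<in> vector_fields A \<Longrightarrow> T (X + Y) = T X + T Y"
    and fmult: "\<And>X f. X \<in> vector_fields A \<Longrightarrow> smooth_fun_on A UNIV f \<Longrightarrow>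
      T (\<lambda>p. f p *\<^sub>R X p) = f p *\<^sub>R T X"
    and X: "X \<in> vector_fields A"
  shows "T X = (\<Sum>i\<in>I. ip X (F i) p *\<^sub>R T (E i))"
proof -
  define S where "S i = (\<lambda>q. ip X (F i) q *\<^sub>R E i q)" for i
  have S: "S i \<in> vector_fields A" if "i \<in> I" for i
    unfolding S_def by (rule vector_field_fmult[OF frame(1)[OF that] ip_smooth[OF X frame(2)[OF that]]])
  have "X = (\<Sum>i\<in>I. S i)"
    using frame_expand[OF vector_field_tangent[OF X]]
    by (intro ext[where f=X]) (simp add: sum_fun_apply S_def ip_def)
  moreover have "T (\<Sum>i\<in>J. S i) = (\<Sum>i\<in>J. T (S i))" if "J \<subseteq> I" for J
    using finite_subset[OF that finite_I] that
  proof (induction J)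
    case empty
    have "T 0 = T 0 + T 0" using add[OF vector_field_zero vector_field_zero] by (metis add_0)
    then show ?case unfolding sum.empty by (metis add_cancel_right_right)
  next
    case (insert i J)
    then have "T (S i + sum S J) = T (S i) + T (sum S J)"
      using S by (intro add subspace_sum[OF subspace_vector_fields]) auto
    then have "T (sum S (insert i J)) = T (S i) + T (sum S J)"
      by (subst sum.insert[OF insert.hyps])
    moreover have "T (sum S J) = (\<Sum>i\<in>J. T (S i))" using insert by auto
    ultimately show ?case by (simp only: sum.insert[OF insert.hyps])
  qed
  moreover have "T (S i) = ip X (F i) p *\<^sub>R T (E i)" if "i \<in> I" for i
    unfolding S_def by (rule fmult[OF frame(1)[OF that] ip_smooth[OF X frame(2)[OF that]]])
  ultimately show ?thesis by simp
qed

lemma vector_field_eqI: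
  assumes "X \<in> vector_fields A" "Y \<in> vector_fields A"
    and "\<And>Z p. Z \<in> vector_fields A \<Longrightarrow> ip X Z p = ip Y Z p"
  shows "X = Y"
proof
  fix p
  have "(\<Sum>i\<in>I. g p (X p) (F i p) *\<^sub>R E i p) = (\<Sum>i\<in>I. g p (Y p) (F i p) *\<^sub>R E i p)"
    using assms(3)[unfolded ip_def] frame by (intro sum.cong) auto
  then show "X p = Y p"
    using frame_expand[OF vector_field_tangent[OF assms(1)]] frame_expand[OF vector_field_tangent[OF assms(2)]]
    by metis
qed

lemma levi_civita_exists: "\<exists>D. is_levi_civita A g D"
proof
  \<comment> \<open>The field whose product with each \<open>F i\<close> is half the Koszul
    expression. Tensoriality of \<open>koszul\<close> in its last argument then yields
    \<open>K\<close> for every \<open>Z\<close>.\<close>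
  define D where "D X Y = (\<Sum>i\<in>I. (\<lambda>p. (koszul X Y (F i) p / 2) *\<^sub>R E i p))" for X Y
  have vf: "D X Y \<in> vector_fields A" if "X \<in> vector_fields A" "Y \<in> vector_fields A" for X Y
    unfolding D_def
  proof (intro subspace_sum subspace_vector_fields vector_field_fmult frame)
    fix i assume "i \<in> I"
    then show "smooth_fun_on A UNIV (\<lambda>p. koszul X Y (F i) p / 2)"
      using smooth_fun_on_cmult[OF open_UNIV koszul_smooth[OF that frame(2)], of i "1/2"] by simp
  qed
  have K: "ip (D X Y) Z p = koszul X Y Z p / 2"
    if V: "X \<in> vector_fields A" "Y \<in> vector_fields A" "Z \<in> vector_fields A" for X Y Z p
  proof -
    \<comment> \<open>\<open>D\<close> is built from the values of \<open>koszul\<close> at the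
      \<open>F i\<close>, so \<open>Z\<close> has to be expanded in the dual frame.\<close>
    interpret swap: framed_manifold A g I F E by (rule frame_swap)
    have "koszul X Y Z p = (\<Sum>i\<in>I. ip Z (E i) p * koszul X Y (F i) p)"
      using swap.tensorial_expand[of "\<lambda>Z. koszul X Y Z p" p Z] V by (simp add: koszul_add koszul_fmult)
    moreover have "D X Y p = (\<Sum>i\<in>I. (koszul X Y (F i) p / 2) *\<^sub>R E i p)"
      unfolding D_def by (rule sum_fun_apply)
    then have "ip (D X Y) Z p = (\<Sum>i\<in>I. koszul X Y (F i) p / 2 * ip (E i) Z p)"
      unfolding ip_def using V frame
      by (simp only:, subst metric_sum_left) (auto simp: metric_scale_left vector_field_tangent
          subspace_scale[OF subspace_tangent_space])
    moreover have "ip Z (E i) p = ip (E i) Z p" if "i \<in> I" for i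
      using ip_sym[OF V(3) frame(1)[OF that]] by simp
    ultimately show ?thesis by (simp add: sum_divide_distrib mult_ac)
  qed
  have "affine_connection A D"
    unfolding affine_connection_def
  proof (intro conjI ballI allI impI)
    fix X Y Z assume V: "X \<in> vector_fields A" "Y \<in> vector_fields A" "Z \<in> vector_fields A"
    show "D (X + Y) Z = D X Z + D Y Z" "D X (Y + Z) = D X Y + D X Z"
      by (rule vector_field_eqI;
          use V in \<open>simp add: vf vector_field_add K ip_add_left koszul_add add_divide_distrib\<close>)+
  next
    fix X Y f assume V: "X \<in> vector_fields A" "Y \<in> vector_fields A" and f: "smooth_fun_on A UNIV f"
    have Xf: "smooth_fun_on A UNIV (\<lambda>p. X p f)" using vector_field_smooth[OF V(1) open_UNIV f] .
    show "D (\<lambda>p. f p *\<^sub>R X p) Y = (\<lambda>p. f p *\<^sub>R D X Y p)"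
      by (rule vector_field_eqI)
         (use V f in \<open>simp_all add: vf vector_field_fmult K ip_fmult_left koszul_fmult\<close>)
    have "D X (\<lambda>p. f p *\<^sub>R Y p) = (\<lambda>p. X p f *\<^sub>R Y p) + (\<lambda>p. f p *\<^sub>R D X Y p)"
      by (rule vector_field_eqI)
         (use V f Xf in \<open>simp_all add: vf vector_field_add vector_field_fmult K ip_fmult_left
            koszul_fmult ip_add_left add_divide_distrib\<close>)
    then show "D X (\<lambda>p. f p *\<^sub>R Y p) = (\<lambda>p. X p f *\<^sub>R Y p + f p *\<^sub>R D X Y p)"
      by (simp add: plus_fun_def)
  qed (use vf in blast)
  moreover have "D X Y - D Y X = vf_bracket A X Y" if V: "X \<in> vector_fields A" "Y \<in> vector_fields A" for X Y
  proof (rule vector_field_eqI)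
    fix Z p assume Z: "Z \<in> vector_fields A"
    have "ip (vf_bracket A Y X) Z p = - ip (vf_bracket A X Y) Z p"
      using V Z metric_scale_left[of "vf_bracket A X Y p" p "Z p" "-1"]
      by (subst vf_bracket_antisym) (simp add: ip_def vf_bracket_tangent vector_field_tangent)
    then show "ip (D X Y - D Y X) Z p = ip (vf_bracket A X Y) Z p"
      using V Z by (simp add: ip_diff_left vf K koszul_def ip_sym[OF V(2,1)] add_divide_distrib diff_divide_distrib)
  next
    show "D X Y - D Y X \<in> vector_fields A" by (intro subspace_diff[OF subspace_vector_fields] vf V)
  qed (rule vf_bracket_vector_field[OF V])
  moreover have "X p (ip Y Z) = ip (D X Y) Z p + ip (D X Z) Y p"
    if V: "X \<in> vector_fields A" "Y \<in> vector_fields A" "Z \<in> vector_fields A" for X Y Z p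
  proof -
    have "ip (vf_bracket A Z Y) X p = - ip (vf_bracket A Y Z) X p"
      using V metric_scale_left[of "vf_bracket A Y Z p" p "X p" "-1"]
      by (subst vf_bracket_antisym) (simp add: ip_def vf_bracket_tangent vector_field_tangent)
    then show ?thesis
      using V by (simp add: K koszul_def ip_sym[OF V(3,2)] field_simps)
  qed
  ultimately show "is_levi_civita A g D"
    unfolding is_levi_civita_def using vf
    by (simp add: ip_def[abs_def] metric_sym[OF vector_field_tangent vector_field_tangent])
qed

section \<open>Connection, curvature and tensoriality\<close>

abbreviation L where "L \<equiv> levi_civita A g"

lemma is_levi_civita_L: "is_levi_civita A g L"
  unfolding levi_civita_def using levi_civita_exists by (rule someI_ex)

lemma L_vector_field: "X \<in> vector_fields A \<Longrightarrow> Y \<in> vector_fields A \<Longrightarrow> L X Y \<in> vector_fields A"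
  using is_levi_civita_L by (simp add: is_levi_civita_def affine_connection_def)

lemma
  assumes "X \<in> vector_fields A" "Y \<in> vector_fields A" "Z \<in> vector_fields A"
  shows L_add_left: "L (X + Y) Z = L X Z + L Y Z"
    and L_add_right: "L X (Y + Z) = L X Y + L X Z"
  using is_levi_civita_L assms by (simp_all add: is_levi_civita_def affine_connection_def)

lemma
  assumes "X \<in> vector_fields A" "Y \<in> vector_fields A" "smooth_fun_on A UNIV f"
  shows L_fmult_left: "L (\<lambda>p. f p *\<^sub>R X p) Y = (\<lambda>p. f p *\<^sub>R L X Y p)"
    and L_fmult_right: "L X (\<lambda>p. f p *\<^sub>R Y p) = (\<lambda>p. X p f *\<^sub>R Y p) + (\<lambda>p. f p *\<^sub>R L X Y p)"
  using is_levi_civita_L assms by (auto simp: is_levi_civita_def affine_connection_def plus_fun_def)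

lemma L_uminus_left:
  assumes "X \<in> vector_fields A" "Y \<in> vector_fields A"
  shows "L (- X) Y = - L X Y"
  using L_fmult_left[OF assms smooth_fun_on_const[OF open_UNIV], of "-1"]
  by (simp add: fun_Compl_def)

lemma curvature_vector_field:
  "X \<in> vector_fields A \<Longrightarrow> Y \<in> vector_fields A \<Longrightarrow> Z \<in> vector_fields A \<Longrightarrow>
    curvature A g X Y Z \<in> vector_fields A"
  unfolding curvature_def
  by (intro subspace_diff[OF subspace_vector_fields] L_vector_field vf_bracket_vector_field)

text \<open>Transfers tensoriality from the first argument to the second in
  \<open>curvature_cong\<close>.\<close>

lemma curvature_antisym:
  assumes "X \<in> vector_fields A" "Y \<in> vector_fields A" "Z \<in> vector_fields A"
  shows "curvature A g X Y Z = - curvature A g Y X Z"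
  unfolding curvature_def
  using L_uminus_left[OF vf_bracket_vector_field[OF assms(2,1)] assms(3)]
  by (simp add: vf_bracket_antisym[of X Y])

lemma
  assumes V: "X \<in> vector_fields A" "Y \<in> vector_fields A" "Z \<in> vector_fields A" "W \<in> vector_fields A"
  shows curvature_add_left: "curvature A g (X + W) Y Z = curvature A g X Y Z + curvature A g W Y Z"
    and curvature_add_right: "curvature A g X Y (Z + W) = curvature A g X Y Z + curvature A g X Y W"
  using V by (simp_all add: curvature_def L_add_left L_add_right vf_bracket_add_left L_vector_field
      vf_bracket_vector_field)

text \<open>The derivative \<open>Y f\<close> arises once from \<open>L Y\<close> applied to the
  multiple of \<open>L X Z\<close> and once from the bracket, with opposite signs.\<close>

lemma curvature_fmult_left:
  assumes V: "X \<in> vector_fields A" "Y \<in> vector_fields A" "Z \<in> vector_fields A"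
    and f: "smooth_fun_on A UNIV f"
  shows "curvature A g (\<lambda>p. f p *\<^sub>R X p) Y Z = (\<lambda>p. f p *\<^sub>R curvature A g X Y Z p)"
proof -
  have Yf: "smooth_fun_on A UNIV (\<lambda>p. - Y p f)"
    using smooth_fun_on_cmult[OF open_UNIV vector_field_smooth[OF V(2) open_UNIV f], of "-1"] by simp
  have "vf_bracket A (\<lambda>p. f p *\<^sub>R X p) Y = (\<lambda>p. f p *\<^sub>R vf_bracket A X Y p) + (\<lambda>p. (- Y p f) *\<^sub>R X p)"
    using vf_bracket_fmult_left[OF V(1,2) f] by (simp add: fun_eq_iff)
  then have "L (vf_bracket A (\<lambda>p. f p *\<^sub>R X p) Y) Z =
      (\<lambda>p. f p *\<^sub>R L (vf_bracket A X Y) Z p) + (\<lambda>p. (- Y p f) *\<^sub>R L X Z p)"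
    using V f Yf by (simp only: L_add_left L_fmult_left vector_field_fmult vf_bracket_vector_field)
  then show ?thesis
    using V f by (simp add: curvature_def L_fmult_left L_fmult_right L_vector_field fun_eq_iff algebra_simps)
qed

text \<open>The second derivatives of \<open>f\<close> form the commutator
  \<open>X (Y f) - Y (X f)\<close>, which the bracket term removes; the mixed first-order terms are
  symmetric in \<open>X\<close> and \<open>Y\<close> and cancel.\<close>

lemma curvature_fmult_right:
  assumes V: "X \<in> vector_fields A" "Y \<in> vector_fields A" "Z \<in> vector_fields A"
    and f: "smooth_fun_on A UNIV f"
  shows "curvature A g X Y (\<lambda>p. f p *\<^sub>R Z p) = (\<lambda>p. f p *\<^sub>R curvature A g X Y Z p)"
proof -
  have sm: "smooth_fun_on A UNIV (\<lambda>p. X p f)" "smooth_fun_on A UNIV (\<lambda>p. Y p f)"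
    using vector_field_smooth[OF _ open_UNIV f] V by auto
  have LL: "L X (L Y (\<lambda>p. f p *\<^sub>R Z p)) p = X p (\<lambda>p. Y p f) *\<^sub>R Z p + Y p f *\<^sub>R L X Z p
      + (X p f *\<^sub>R L Y Z p + f p *\<^sub>R L X (L Y Z) p)"
    if "X \<in> vector_fields A" "Y \<in> vector_fields A" "smooth_fun_on A UNIV (\<lambda>p. Y p f)" for X Y p
    using that V(3) f
    by (simp add: L_fmult_right L_add_right vector_field_fmult L_vector_field)
  have br: "vf_bracket A X Y p f = X p (\<lambda>p. Y p f) - Y p (\<lambda>p. X p f)" for p
    using smooth_fun_on_imp_at[OF f] by (rule vf_bracket_apply)
  have L_br: "L (vf_bracket A X Y) (\<lambda>p. f p *\<^sub>R Z p) p =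
      vf_bracket A X Y p f *\<^sub>R Z p + f p *\<^sub>R L (vf_bracket A X Y) Z p" for p
    by (simp add: L_fmult_right[OF vf_bracket_vector_field[OF V(1,2)] V(3) f])
  show ?thesis
  proof
    fix p
    show "curvature A g X Y (\<lambda>p. f p *\<^sub>R Z p) p = f p *\<^sub>R curvature A g X Y Z p"
      unfolding curvature_def minus_apply[where A="_ - _" and x=p] minus_apply[where x=p and A="L _ _"]
        LL[OF V(1,2) sm(2)] LL[OF V(2,1) sm(1)] L_br br
      by (simp only: scaleR_diff_right scaleR_diff_left) (simp only: algebra_simps)
  qed
qed

text \<open>One argument at a time, the frame expansions at \<open>p\<close> coincide, because their
  coefficients involve only the values of the fields at \<open>p\<close>.\<close>

lemma curvature_cong:
  assumes V: "X \<in> vector_fields A" "Y \<in> vector_fields A" "Z \<in> vector_fields A"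
    "X' \<in> vector_fields A" "Y' \<in> vector_fields A" "Z' \<in> vector_fields A"
    and eq: "X p = X' p" "Y p = Y' p" "Z p = Z' p"
  shows "curvature A g X Y Z p = curvature A g X' Y' Z' p"
proof -
  have left: "curvature A g X Y Z p = curvature A g X' Y Z p"
    if "X \<in> vector_fields A" "X' \<in> vector_fields A" "Y \<in> vector_fields A" "Z \<in> vector_fields A" "X p = X' p"
    for X X' Y Z
    using tensorial_expand[of "\<lambda>X. curvature A g X Y Z p" p X]
      tensorial_expand[of "\<lambda>X. curvature A g X Y Z p" p X'] that
    by (simp add: curvature_add_left curvature_fmult_left ip_def)
  have right: "curvature A g X Y Z p = curvature A g X Y Z' p"
    if "X \<in> vector_fields A" "Y \<in> vector_fields A" "Z \<in> vector_fields A" "Z' \<in> vector_fields A" "Z p = Z' p"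
    for X Y Z Z'
    using tensorial_expand[of "\<lambda>Z. curvature A g X Y Z p" p Z]
      tensorial_expand[of "\<lambda>Z. curvature A g X Y Z p" p Z'] that
    by (simp add: curvature_add_right curvature_fmult_right ip_def)
  have "curvature A g X Y Z p = curvature A g X' Y Z p" using left V eq by blast
  also have "\<dots> = - curvature A g Y X' Z p" using V by (subst curvature_antisym) auto
  also have "\<dots> = - curvature A g Y' X' Z p" using left[of Y Y' X' Z] V eq by simp
  also have "\<dots> = curvature A g X' Y' Z p" using V by (subst curvature_antisym) auto
  also have "\<dots> = curvature A g X' Y' Z' p" using right V eq by blast
  finally show ?thesis .
qed

end

section \<open>Naturality of connection and curvature under isometries\<close>

locale manifold_isometry = framed_manifold A g I E F + manifold_diffeo A \<phi>
  for A :: "('m::{t2_space, second_countable_topology}, 'e::euclidean_space) chart set"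
    and g I and E F :: "'i \<Rightarrow> 'm \<Rightarrow> 'm tangent" and \<phi> +
  assumes isometry: "u \<in> tangent_space A p \<Longrightarrow> w \<in> tangent_space A p \<Longrightarrow>
      g (\<phi> p) (differential A \<phi> p u) (differential A \<phi> p w) = g p u w"
begin

lemma ip_push:
  "X \<in> vector_fields A \<Longrightarrow> Y \<in> vector_fields A \<Longrightarrow> ip (push X) (push Y) (\<phi> p) = ip X Y p"
  by (simp add: ip_def push_at isometry vector_field_tangent)

text \<open>Metric and bracket are natural, and \<open>push X\<close> differentiates a function the
  way \<open>X\<close> differentiates its pull-back, so the six terms agree one by one.\<close>

lemma koszul_push:
  assumes "X \<in> vector_fields A" "Y \<in> vector_fields A" "Z \<in> vector_fields A"
  shows "koszul (push X) (push Y) (push Z) (\<phi> p) = koszul X Y Z p"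
proof -
  have "ip (push X) (push Y) \<circ> \<phi> = ip X Y" if "X \<in> vector_fields A" "Y \<in> vector_fields A" for X Y
    using ip_push[OF that] by (simp add: fun_eq_iff)
  then show ?thesis
    using assms by (simp add: koszul_def push_apply ip_push vf_bracket_vector_field flip: push_bracket)
qed

text \<open>Push-forward by the inverse. It lets an arbitrary test field be written as a pushed one,
  the only kind that \<open>koszul_push\<close> speaks about.\<close>

lemma push_surj:
  assumes Z: "Z \<in> vector_fields A"
  obtains Z' where "Z' \<in> vector_fields A" "push Z' = Z"
proof -
  have inv: "inv_into UNIV \<psi> = \<phi>"
    by (rule inv_equality) auto
  interpret inv: manifold_diffeo A \<psi>
    using diffeo by unfold_locales (auto simp: diffeomorphism_def inv bij_imp_bij_inv)
  have "push (inv.push Z) q f = Z q f" for q f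
  proof -
    have "push (inv.push Z) (\<phi> (\<psi> q)) f = inv.push Z (\<psi> q) (f \<circ> \<phi>)"
      by (intro push_apply inv.push_vector_field Z)
    also have "\<dots> = Z q (f \<circ> \<phi> \<circ> \<psi>)"
      by (rule inv.push_apply[OF Z])
    also have "f \<circ> \<phi> \<circ> \<psi> = f" by auto
    finally show ?thesis by simp
  qed
  then have "push (inv.push Z) = Z" by blast
  then show ?thesis using that inv.push_vector_field[OF Z] by blast
qed

lemma L_push:
  assumes V: "X \<in> vector_fields A" "Y \<in> vector_fields A"
  shows "L (push X) (push Y) = push (L X Y)"
proof (rule vector_field_eqI)
  fix Z q assume Z: "Z \<in> vector_fields A"
  then obtain Z' where Z': "Z' \<in> vector_fields A" "Z = push Z'" using push_surj by metis
  obtain p where q: "q = \<phi> p" using inverse_simps(2) by metis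
  have "2 * ip (L (push X) (push Y)) Z q = koszul X Y Z' p"
    using levi_civita_koszul[OF is_levi_civita_L push_vector_field[OF V(1)] push_vector_field[OF V(2)] Z]
      koszul_push[OF V Z'(1)] by (simp add: Z'(2) q)
  also have "\<dots> = 2 * ip (push (L X Y)) Z q"
    using levi_civita_koszul[OF is_levi_civita_L V Z'(1)] by (simp add: ip_push L_vector_field V Z' q)
  finally show "ip (L (push X) (push Y)) Z q = ip (push (L X Y)) Z q" by simp
qed (intro L_vector_field push_vector_field V)+

lemma push_diff: "push (X - Y) = push X - push Y"
  by (simp add: fun_eq_iff push_def linear_diff[OF linear_differential])

lemma curvature_push:
  "X \<in> vector_fields A \<Longrightarrow> Y \<in> vector_fields A \<Longrightarrow> Z \<in> vector_fields A \<Longrightarrow>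
    curvature A g (push X) (push Y) (push Z) = push (curvature A g X Y Z)"
  by (simp add: curvature_def L_push push_diff L_vector_field vf_bracket_vector_field flip: push_bracket)

end

section \<open>Traces, dual bases and generalised eigenspaces\<close>

text \<open>Linearity is asked on \<open>V\<close> alone, since operators built from
  \<open>levi_civita\<close> are uncontrolled outside smooth vector fields.\<close>

lemma linear_on_sum:
  fixes h :: "'v::real_vector \<Rightarrow> 'w::real_vector"
  assumes V: "subspace V"
    and add: "\<And>x y. x \<in> V \<Longrightarrow> y \<in> V \<Longrightarrow> h (x + y) = h x + h y"
    and scale: "\<And>a x. x \<in> V \<Longrightarrow> h (a *\<^sub>R x) = a *\<^sub>R h x"
    and x: "\<And>i. i \<in> I \<Longrightarrow> x i \<in> V"
  shows "h (\<Sum>i\<in>I. c i *\<^sub>R x i) = (\<Sum>i\<in>I. c i *\<^sub>R h (x i))"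
  using x
proof (induction I rule: infinite_finite_induct)
  case (insert i I)
  let ?s = "\<Sum>i\<in>I. c i *\<^sub>R x i"
  have "?s \<in> V" "c i *\<^sub>R x i \<in> V"
    using insert.prems V by (auto intro!: subspace_sum subspace_scale)
  then have "h (c i *\<^sub>R x i + ?s) = c i *\<^sub>R h (x i) + h ?s"
    using add scale insert.prems by simp
  moreover have "h ?s = (\<Sum>i\<in>I. c i *\<^sub>R h (x i))" using insert by simp
  ultimately show ?case by (simp only: sum.insert[OF insert.hyps])
qed (use scale[OF subspace_0[OF V], of 0] in simp_all)

lemma representation_sum_finite:
  fixes B :: "'v::real_vector set"
  assumes "finite B" "independent B" "v \<in> span B"
  shows "(\<Sum>b\<in>B. representation B v b *\<^sub>R b) = v"
  using assms by (intro real_vector.sum_representation_eq) auto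

text \<open>The basis \<open>C\<close> behind \<open>trace_on\<close> is an arbitrary choice.
  Expanding each basis in the other rewrites both traces as the same double sum, which is the
  invariance of the trace under cyclic exchange.\<close>

lemma trace_on_basis:
  fixes B :: "'v::real_vector set"
  assumes B: "finite B" "independent B" "span B = V"
    and S: "\<And>x. x \<in> V \<Longrightarrow> S x \<in> V"
    and add: "\<And>x y. x \<in> V \<Longrightarrow> y \<in> V \<Longrightarrow> S (x + y) = S x + S y"
    and scale: "\<And>a x. x \<in> V \<Longrightarrow> S (a *\<^sub>R x) = a *\<^sub>R S x"
  shows "trace_on V S = (\<Sum>b\<in>B. representation B (S b) b)"
proof -
  define C where "C = (SOME B. independent B \<and> span B = V)"
  have "independent C \<and> span C = V"
    unfolding C_def by (rule someI[of _ B]) (use B in simp)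
  then have C: "independent C" "span C = V" by auto
  have "finite C"
    using real_vector.independent_span_bound[OF B(1) C(1)] B(3) C(2) real_vector.span_superset by blast
  note C = this C
  have in_V: "b \<in> V" if "b \<in> B \<or> b \<in> C" for b
    using that B(3) C(3) real_vector.span_base by auto
  have V: "subspace V" using B(3) by auto
  have "representation B (S b) b =
      (\<Sum>c\<in>C. representation C b c * representation B (S c) b)" if b: "b \<in> B" for b
  proof -
    have "S b = S (\<Sum>c\<in>C. representation C b c *\<^sub>R c)"
      using representation_sum_finite[OF C(1,2)] in_V b C(3) by simp
    also have "\<dots> = (\<Sum>c\<in>C. representation C b c *\<^sub>R S c)"
      by (rule linear_on_sum[OF V add scale]) (use in_V in auto)
    finally have Sb: "S b = (\<Sum>c\<in>C. representation C b c *\<^sub>R S c)" .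
    show ?thesis
      unfolding Sb using S in_V V B
      by (subst real_vector.representation_sum)
         (auto simp: real_vector.representation_scale intro!: sum.cong subspace_scale)
  qed
  then have "(\<Sum>b\<in>B. representation B (S b) b) =
      (\<Sum>b\<in>B. \<Sum>c\<in>C. representation C b c * representation B (S c) b)" by simp
  also have "\<dots> = (\<Sum>c\<in>C. \<Sum>b\<in>B. representation B (S c) b * representation C b c)"
    by (subst sum.swap) (simp add: mult.commute)
  also have "\<dots> = (\<Sum>c\<in>C. representation C (S c) c)"
  proof (rule sum.cong[OF refl])
    fix c assume c: "c \<in> C"
    have "representation C (\<Sum>b\<in>B. representation B (S c) b *\<^sub>R b) c =
        (\<Sum>b\<in>B. representation B (S c) b * representation C b c)"
      using in_V V C
      by (subst real_vector.representation_sum)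
         (auto simp: real_vector.representation_scale intro!: sum.cong subspace_scale)
    moreover have "(\<Sum>b\<in>B. representation B (S c) b *\<^sub>R b) = S c"
      using representation_sum_finite[OF B(1,2)] S in_V c B(3) by simp
    ultimately show "(\<Sum>b\<in>B. representation B (S c) b * representation C b c) = representation C (S c) c"
      by simp
  qed
  finally show ?thesis by (simp add: trace_on_def C_def Let_def)
qed

lemma trace_on_conjugate:
  fixes B :: "'v::real_vector set" and T :: "'v \<Rightarrow> 'v"
  assumes B: "finite B" "independent B" "span B = V"
    and T: "linear T" "inj_on T V" "T ` V = V"
    and S: "\<And>x. x \<in> V \<Longrightarrow> S x \<in> V"
      "\<And>x y. x \<in> V \<Longrightarrow> y \<in> V \<Longrightarrow> S (x + y) = S x + S y"
      "\<And>a x. x \<in> V \<Longrightarrow> S (a *\<^sub>R x) = a *\<^sub>R S x"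
    and S': "\<And>x. x \<in> V \<Longrightarrow> S' x \<in> V"
      "\<And>x y. x \<in> V \<Longrightarrow> y \<in> V \<Longrightarrow> S' (x + y) = S' x + S' y"
      "\<And>a x. x \<in> V \<Longrightarrow> S' (a *\<^sub>R x) = a *\<^sub>R S' x"
    and conj: "\<And>x. x \<in> V \<Longrightarrow> S' (T x) = T (S x)"
  shows "trace_on V S' = trace_on V S"
proof -
  have TB: "finite (T ` B)" "independent (T ` B)" "span (T ` B) = V"
    using B T linear_independent_injective_image[OF T(1) B(2)] by (simp_all add: linear_span_image)
  have in_V: "b \<in> V" if "b \<in> B" for b using that B(3) real_vector.span_base by auto
  have V: "subspace V" using B(3) by auto
  have rep: "representation (T ` B) (T x) (T b) = representation B x b" if x: "x \<in> V" and b: "b \<in> B" for x b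
  proof -
    have "T x = T (\<Sum>c\<in>B. representation B x c *\<^sub>R c)"
      using representation_sum_finite[OF B(1,2)] x B(3) by simp
    also have "\<dots> = (\<Sum>c\<in>B. representation B x c *\<^sub>R T c)"
      by (rule linear_on_sum[OF V]) (use T(1) in_V in \<open>auto simp: linear_add linear_scale\<close>)
    finally have Tx: "T x = (\<Sum>c\<in>B. representation B x c *\<^sub>R T c)" .
    have "representation (T ` B) (T x) (T b) =
        (\<Sum>c\<in>B. representation B x c * representation (T ` B) (T c) (T b))"
    proof -
      have T_in: "T c \<in> span (T ` B)" if "c \<in> B" for c using that by (simp add: span_base)
      show ?thesis
        unfolding Tx
        by (subst real_vector.representation_sum[OF TB(2)])
           (use T_in real_vector.representation_scale[OF TB(2)] in \<open>auto intro: span_scale\<close>)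
    qed
    also have "\<dots> = (\<Sum>c\<in>B. representation B x c * (if c = b then 1 else 0))"
      using TB(2) T(2) in_V b
      by (intro sum.cong refl) (auto simp: real_vector.representation_basis inj_on_eq_iff)
    finally show ?thesis using B(1) b by (simp add: if_distrib cong: if_cong)
  qed
  have "trace_on V S' = (\<Sum>b\<in>T ` B. representation (T ` B) (S' b) b)"
    by (rule trace_on_basis[OF TB S'])
  also have "\<dots> = (\<Sum>b\<in>B. representation (T ` B) (T (S b)) (T b))"
    using T(2) in_V conj by (subst sum.reindex) (auto intro: inj_on_subset)
  also have "\<dots> = (\<Sum>b\<in>B. representation B (S b) b)"
    using rep S(1) in_V by simp
  also have "\<dots> = trace_on V S"
    by (rule trace_on_basis[OF B S, symmetric])
  finally show ?thesis .
qed

text \<open>Nondegeneracy makes the map from \<open>x\<close> to its products with the basis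
  injective. By a dimension count it reaches every function supported on \<open>B\<close>, and
  \<open>F b\<close> is the preimage of the indicator of \<open>b\<close>.\<close>

lemma dual_basis_exists:
  fixes B :: "'v::real_vector set" and form :: "'v \<Rightarrow> 'v \<Rightarrow> real"
  assumes B: "finite B" "independent B" "span B = V"
    and sym: "\<And>x y. x \<in> V \<Longrightarrow> y \<in> V \<Longrightarrow> form x y = form y x"
    and add: "\<And>x y z. x \<in> V \<Longrightarrow> y \<in> V \<Longrightarrow> z \<in> V \<Longrightarrow> form (x + y) z = form x z + form y z"
    and scale: "\<And>a x z. x \<in> V \<Longrightarrow> z \<in> V \<Longrightarrow> form (a *\<^sub>R x) z = a * form x z"
    and nondeg: "nondegenerate_on form V"
  obtains F where "\<And>b. b \<in> B \<Longrightarrow> F b \<in> V"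
    and "\<And>x. x \<in> V \<Longrightarrow> x = (\<Sum>b\<in>B. form x (F b) *\<^sub>R b)"
proof -
  have in_V: "b \<in> V" if "b \<in> B" for b using that B(3) real_vector.span_base by auto
  have V: "subspace V" using B(3) by auto
  have expand: "form x y = (\<Sum>b\<in>B. representation B x b * form b y)" if x: "x \<in> V" and y: "y \<in> V" for x y
  proof -
    have "form x y = form (\<Sum>b\<in>B. representation B x b *\<^sub>R b) y"
      using representation_sum_finite[OF B(1,2)] x B(3) by simp
    also have "\<dots> = (\<Sum>b\<in>B. representation B x b *\<^sub>R form b y)"
      by (rule linear_on_sum[OF V, of "\<lambda>x. form x y"]) (use add scale y in_V in auto)
    finally show ?thesis by simp
  qed
  \<comment> \<open>Cut off outside \<open>B\<close>, so that the image lies in the span of the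
    finitely many indicators \<open>e b\<close>.\<close>
  define h where "h b y = (if y \<in> B then form b y else 0)" for b y
  obtain f where f: "linear f" "\<And>b. b \<in> B \<Longrightarrow> f b = h b"
    using linear_independent_extend[OF B(2), of h] by blast
  have f_eq: "f x y = (if y \<in> B then form x y else 0)" if x: "x \<in> V" for x y
  proof -
    have "f x = f (\<Sum>b\<in>B. representation B x b *\<^sub>R b)"
      using representation_sum_finite[OF B(1,2)] x B(3) by simp
    also have "\<dots> = (\<Sum>b\<in>B. representation B x b *\<^sub>R h b)"
      using f by (simp add: linear_sum linear_scale)
    finally show ?thesis
      using expand[OF x in_V] by (simp add: sum_fun_apply scaleR_fun_apply h_def)
  qed
  have inj: "inj_on f V"
  proof (rule inj_onI)
    fix x y assume xy: "x \<in> V" "y \<in> V" "f x = f y"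
    have d: "x - y \<in> V" using xy V by (simp add: subspace_diff)
    have "form (x - y) b = 0" if "b \<in> B" for b
      using f_eq[OF d, of b] that linear_diff[OF f(1), of x y] xy(3) by simp
    then have "form z (x - y) = 0" if "z \<in> V" for z
      using expand[OF that d] sym[OF d in_V] by simp
    then show "x = y"
      using nondeg d sym by (auto simp: nondegenerate_on_def)
  qed
  define e where "e b = (\<lambda>y. if y = b then 1 else 0 :: real)" for b :: 'v
  have fB: "independent (f ` B)" "card (f ` B) = card B" "finite (f ` B)"
    using B f(1) inj linear_independent_injective_image[OF f(1) B(2)] inj_on_subset[OF inj, of B] in_V
    by (auto intro: card_image)
  have fB_span: "f ` B \<subseteq> span (e ` B)"
  proof clarify
    fix b assume "b \<in> B"
    have "f b = (\<Sum>c\<in>B. form b c *\<^sub>R e c)"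
    proof
      fix y
      show "f b y = (\<Sum>c\<in>B. form b c *\<^sub>R e c) y"
        using f_eq[OF in_V[OF \<open>b \<in> B\<close>]] B(1)
        by (simp add: sum_fun_apply scaleR_fun_apply e_def if_distrib cong: if_cong)
    qed
    then show "f b \<in> span (e ` B)" by (simp add: span_sum span_scale span_base)
  qed
  have "\<exists>x\<in>V. f x = e b" if b: "b \<in> B" for b
  proof (rule ccontr)
    assume "\<not> ?thesis"
    then have "e b \<notin> span (f ` B)"
      using linear_span_image[OF f(1), of B] B(3) by auto
    \<comment> \<open>Adjoining \<open>e b\<close> would give \<open>card B + 1\<close> independent
      vectors in a space spanned by at most \<open>card B\<close> vectors.\<close>
    then have ins: "independent (insert (e b) (f ` B))" "e b \<notin> f ` B"
      using independent_insertI[OF _ fB(1)] span_base[of "e b" "f ` B"] by auto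
    have "card (insert (e b) (f ` B)) \<le> card (e ` B)"
      using real_vector.independent_span_bound[of "e ` B", OF _ ins(1)] B(1) b fB_span
      by (simp add: span_base)
    then show False
      using ins(2) fB(2,3) card_image_le[OF B(1), of e] by simp
  qed
  then obtain F where F: "\<And>b. b \<in> B \<Longrightarrow> F b \<in> V \<and> f (F b) = e b" by metis
  have "x = (\<Sum>b\<in>B. form x (F b) *\<^sub>R b)" if x: "x \<in> V" for x
  proof -
    have "form x (F b) = representation B x b" if b: "b \<in> B" for b
    proof -
      have "form c (F b) = (if c = b then 1 else 0)" if "c \<in> B" for c
        using f_eq[of "F b" c] F[OF b] that sym[OF in_V[OF that]] by (simp add: e_def)
      then have "form x (F b) = (\<Sum>c\<in>B. representation B x c * (if c = b then 1 else 0))"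
        using expand[OF x, of "F b"] F[OF b] by simp
      then show ?thesis
        using B(1) b by (simp add: if_distrib cong: if_cong)
    qed
    then show ?thesis
      using representation_sum_finite[OF B(1,2)] x B(3) by simp
  qed
  then show ?thesis using that F by blast
qed

text \<open>\<open>map_prod T T\<close> is the complex-linear extension of \<open>T\<close>. It
  commutes with \<open>R - z\<close> on the complexification, hence with every iterate, and being
  injective there it both preserves and reflects the kernel of the iterate.\<close>

lemma associated_subspace_equivariant:
  fixes N :: "'v::real_vector set"
  assumes N: "subspace N" and T: "linear T" "inj_on T N" "T ` N = N"
    and R: "\<And>u. u \<in> N \<Longrightarrow> R u \<in> N" "\<And>u. u \<in> N \<Longrightarrow> R (T u) = T (R u)"
    and x: "x \<in> complexification N"
  shows "map_prod T T x \<in> associated_subspace N R z \<longleftrightarrow> x \<in> associated_subspace N R z"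
proof -
  define D where "D y = complexify_op R y - cscale z y" for y
  have TN: "T u \<in> N" if "u \<in> N" for u using that T(3) by blast
  have T0: "u = 0" if "u \<in> N" "T u = 0" for u
    using inj_onD[OF T(2), of u 0] that linear_0[OF T(1)] subspace_0[OF N] by simp
  have D_pair: "D (a, b) = (R a - (Re z *\<^sub>R a - Im z *\<^sub>R b), R b - (Re z *\<^sub>R b + Im z *\<^sub>R a))" for a b
    by (simp add: D_def complexify_op_def cscale_def)
  have D_in: "D y \<in> complexification N" if y: "y \<in> complexification N" for y
  proof -
    obtain a b where y: "y = (a, b)" "a \<in> N" "b \<in> N" using y by (auto simp: complexification_def)
    have "R a - (Re z *\<^sub>R a - Im z *\<^sub>R b) \<in> N" "R b - (Re z *\<^sub>R b + Im z *\<^sub>R a) \<in> N"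
      by (intro subspace_diff[OF N] subspace_add[OF N] subspace_scale[OF N] R(1) y(2,3))+
    then show ?thesis by (simp add: y(1) D_pair complexification_def)
  qed
  have D_T: "D (map_prod T T y) = map_prod T T (D y)" if y: "y \<in> complexification N" for y
  proof -
    obtain a b where y: "y = (a, b)" "a \<in> N" "b \<in> N" using y by (auto simp: complexification_def)
    show ?thesis
      by (simp add: y(1) D_pair R(2)[OF y(2)] R(2)[OF y(3)] linear_diff[OF T(1)] linear_add[OF T(1)]
          linear_scale[OF T(1)])
  qed
  have iter: "(D ^^ k) x \<in> complexification N \<and> (D ^^ k) (map_prod T T x) = map_prod T T ((D ^^ k) x)" for k
    by (induction k) (use x D_in D_T in auto)
  have "map_prod T T y = 0 \<longleftrightarrow> y = 0" if y: "y \<in> complexification N" for y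
  proof -
    obtain a b where y: "y = (a, b)" "a \<in> N" "b \<in> N" using y by (auto simp: complexification_def)
    show ?thesis
      using T0[OF y(2)] T0[OF y(3)] linear_0[OF T(1)] by (auto simp: y(1) zero_prod_def)
  qed
  moreover have "map_prod T T x \<in> complexification N"
    using x TN by (cases x) (simp add: complexification_def)
  moreover have "(\<lambda>y. complexify_op R y - cscale z y) = D"
    by (rule ext, rule D_def[symmetric])
  then have "associated_subspace N R z = {x \<in> complexification N. (D ^^ eigen_multiplicity N R z) x = 0}"
    by (simp only: associated_subspace_def)
  ultimately show ?thesis
    using x iter[of "eigen_multiplicity N R z"] by simp
qed

text \<open>The extension of \<open>T\<close> maps every summand onto itself, and therefore their
  sum; a single real vector is then recovered from the complexification of \<open>W\<close>.\<close>

lemma direct_sum_equivariant: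
  fixes N W :: "'v::real_vector set"
  assumes N: "subspace N" and T: "linear T" "inj_on T N" "T ` N = N"
    and R: "\<And>u. u \<in> N \<Longrightarrow> R u \<in> N" "\<And>u. u \<in> N \<Longrightarrow> R (T u) = T (R u)"
    and W: "is_direct_sum (complexification W) I (\<lambda>i. associated_subspace N R (lam i))"
  shows "T ` W = W"
proof -
  let ?TT = "map_prod T T" and ?E = "\<lambda>i. associated_subspace N R (lam i)"
  have TT_sum: "?TT (\<Sum>i\<in>I. x i) = (\<Sum>i\<in>I. ?TT (x i))" for x :: "'a \<Rightarrow> 'v \<times> 'v"
    by (simp add: prod_eq_iff fst_sum snd_sum linear_sum[OF T(1)])
  have mem_W: "y \<in> complexification W \<longleftrightarrow> (\<exists>x. y = (\<Sum>i\<in>I. x i) \<and> (\<forall>i\<in>I. x i \<in> ?E i))" for y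
    using W by (auto simp: is_direct_sum_def)
  have E_N: "?E i \<subseteq> complexification N" for i by (auto simp: associated_subspace_def)
  have equiv: "?TT x \<in> ?E i \<longleftrightarrow> x \<in> ?E i" if "x \<in> complexification N" for x i
    by (rule associated_subspace_equivariant[OF N T]) (use R that in auto)
  show ?thesis
  proof (intro equalityI subsetI)
    fix y assume "y \<in> T ` W"
    then obtain u where u: "y = T u" "u \<in> W" by blast
    \<comment> \<open>The diagonal vector, \<open>u\<close> tensored with \<open>1 + \<i>\<close>,
      lies in \<open>W \<times> W\<close> exactly when \<open>u\<close> lies in \<open>W\<close>;
      the pair \<open>(u, 0)\<close> would also call for \<open>0 \<in> W\<close>.\<close>
    then have "(u, u) \<in> complexification W" by (simp add: complexification_def)
    then obtain x where x: "(u, u) = (\<Sum>i\<in>I. x i)" "\<And>i. i \<in> I \<Longrightarrow> x i \<in> ?E i"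
      unfolding mem_W by blast
    have "(y, y) = ?TT (u, u)" by (simp add: u)
    also have "\<dots> = (\<Sum>i\<in>I. ?TT (x i))" unfolding x(1) by (rule TT_sum)
    finally have "(y, y) = (\<Sum>i\<in>I. ?TT (x i))" .
    moreover have "?TT (x i) \<in> ?E i" if "i \<in> I" for i
      using equiv[of "x i" i] x(2)[OF that] E_N by blast
    ultimately have "(y, y) \<in> complexification W" unfolding mem_W by blast
    then show "y \<in> W" by (simp add: complexification_def)
  next
    fix y assume "y \<in> W"
    then have "(y, y) \<in> complexification W" by (simp add: complexification_def)
    then obtain x where x: "(y, y) = (\<Sum>i\<in>I. x i)" "\<And>i. i \<in> I \<Longrightarrow> x i \<in> ?E i"
      unfolding mem_W by blast
    \<comment> \<open>Surjectivity of \<open>T\<close> gives a preimage in the complexification of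
      \<open>N\<close>; the equivalence \<open>equiv\<close>, read backwards, places it in the same
      summand.\<close>
    have "\<exists>x'. x i = ?TT x' \<and> x' \<in> ?E i" if i: "i \<in> I" for i
    proof -
      obtain a b where ab: "x i = (a, b)" "a \<in> N" "b \<in> N"
        using x(2)[OF i] E_N by (force simp: complexification_def)
      then obtain a' b' where "a = T a'" "b = T b'" "a' \<in> N" "b' \<in> N" using T(3) by blast
      then have "x i = ?TT (a', b')" "(a', b') \<in> complexification N"
        using ab by (auto simp: complexification_def)
      then show ?thesis using equiv x(2)[OF i] by metis
    qed
    then obtain x' where x': "\<And>i. i \<in> I \<Longrightarrow> x i = ?TT (x' i) \<and> x' i \<in> ?E i" by metis
    have "(y, y) = ?TT (\<Sum>i\<in>I. x' i)"
      unfolding TT_sum x(1) by (rule sum.cong) (use x' in auto)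
    moreover have "(\<Sum>i\<in>I. x' i) \<in> complexification W"
      unfolding mem_W using x' by blast
    ultimately show "y \<in> T ` W" by (auto simp: complexification_def map_prod_def split: prod.splits)
  qed
qed

section \<open>Lie groups\<close>

text \<open>The two chart properties of the product atlas that \<open>smooth_fun_on_compose\<close>
  asks of its source.\<close>

lemma map_prod_chart:
  assumes "smooth_manifold A" "smooth_manifold B" "(U, c) \<in> A" "(V, d) \<in> B"
  shows "inj_on (map_prod c d) (U \<times> V)"
    and "open W \<Longrightarrow> open (map_prod c d ` ((U \<times> V) \<inter> W))"
proof -
  interpret A: smooth_manifold A by fact
  interpret B: smooth_manifold B by fact
  show "inj_on (map_prod c d) (U \<times> V)"
    using A.chart_inj[OF assms(3)] B.chart_inj[OF assms(4)] by (auto simp: inj_on_def)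
  assume W: "open W"
  show "open (map_prod c d ` ((U \<times> V) \<inter> W))"
  proof (subst open_prod_def, intro ballI)
    fix z assume "z \<in> map_prod c d ` ((U \<times> V) \<inter> W)"
    then obtain p q where pq: "z = (c p, d q)" "p \<in> U" "q \<in> V" "(p, q) \<in> W" by auto
    from W pq(4) obtain P Q where PQ: "open P" "open Q" "(p, q) \<in> P \<times> Q" "P \<times> Q \<subseteq> W"
      by (rule open_prod_elim)
    have "z \<in> c ` (U \<inter> P) \<times> d ` (V \<inter> Q)" using pq PQ by auto
    moreover have "c ` (U \<inter> P) \<times> d ` (V \<inter> Q) \<subseteq> map_prod c d ` ((U \<times> V) \<inter> W)"
    proof clarify
      fix x y assume "x \<in> U" "x \<in> P" "y \<in> V" "y \<in> Q"
      then have "(x, y) \<in> (U \<times> V) \<inter> W" using PQ by auto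
      then have "map_prod c d (x, y) \<in> map_prod c d ` ((U \<times> V) \<inter> W)" by (rule imageI)
      then show "(c x, d y) \<in> map_prod c d ` ((U \<times> V) \<inter> W)" by simp
    qed
    ultimately show "\<exists>S T. open S \<and> open T \<and> z \<in> S \<times> T \<and> S \<times> T \<subseteq> map_prod c d ` ((U \<times> V) \<inter> W)"
      using A.open_chart_image[OF assms(3) PQ(1)] B.open_chart_image[OF assms(4) PQ(2)] by blast
  qed
qed

lemma smooth_on_Pair_left:
  fixes S :: "'b::euclidean_space set"
  assumes "open S"
  shows "smooth_on S (\<lambda>y. (x, y))"
  using smooth_on_add[OF assms smooth_on_const[OF assms, of "(x, 0)"]
      smooth_on_bounded_linear[OF assms bounded_linear_Pair[OF bounded_linear_zero bounded_linear_ident]]]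
  by simp

lemma smooth_on_Pair_right:
  fixes S :: "'b::euclidean_space set"
  assumes "open S"
  shows "smooth_on S (\<lambda>y. (y, x))"
  using smooth_on_add[OF assms smooth_on_const[OF assms, of "(0, x)"]
      smooth_on_bounded_linear[OF assms bounded_linear_Pair[OF bounded_linear_ident bounded_linear_zero]]]
  by simp

section \<open>Left translations\<close>

context lie_group
begin

lemma mem_carrier [simp]: "x \<in> carrier G"
  by (simp add: carrier_UNIV)

abbreviation lt :: "'m \<Rightarrow> 'm \<Rightarrow> 'm" where "lt a \<equiv> \<lambda>x. a \<otimes>\<^bsub>G\<^esub> x"

abbreviation mu :: "'m \<times> 'm \<Rightarrow> 'm" where "mu \<equiv> \<lambda>(x, y). x \<otimes>\<^bsub>G\<^esub> y"

lemma inv_into_map_prod: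
  assumes "(U, c) \<in> A" "(V, d) \<in> A" "x \<in> U" "y \<in> V"
  shows "inv_into (U \<times> V) (map_prod c d) (c x, d y) = (x, y)"
  using inv_into_f_f[OF map_prod_chart(1)[OF smooth_manifold_axioms smooth_manifold_axioms assms(1,2)], of "(x, y)"]
    assms(3,4) by simp

lemma continuous_lt: "continuous_on UNIV (lt a)"
proof -
  have "continuous_on UNIV mu" using smooth_mult by (simp add: smooth_map_def)
  from continuous_on_compose2[OF this, of UNIV "\<lambda>x. (a, x)"] show ?thesis
    by (simp add: continuous_intros)
qed

text \<open>Multiplication restricted to a slice with first factor \<open>a\<close>; in coordinates
  the slice is the affine map \<open>y \<mapsto> (ca a, y)\<close>.\<close>

lemma smooth_map_lt: "smooth_map A A (lt a)"
proof -
  have "smooth_on (c ` (U \<inter> lt a -` V)) (d \<circ> lt a \<circ> inv_into U c)"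
    if c: "(U, c) \<in> A" and d: "(V, d) \<in> A" for U c V d
  proof -
    obtain Ua ca where ca: "(Ua, ca) \<in> A" "a \<in> Ua" by (rule chart_at)
    let ?S = "c ` (U \<inter> lt a -` V)"
    let ?T = "map_prod ca c ` ((Ua \<times> U) \<inter> mu -` V)"
    have S: "open ?S"
      using continuous_lt chart_open[OF d] by (intro open_chart_image[OF c] open_vimage) auto
    have T: "open ?T"
    proof (rule map_prod_chart(2)[OF smooth_manifold_axioms smooth_manifold_axioms ca(1) c])
      show "open (mu -` V)"
        using smooth_mult chart_open[OF d] by (intro open_vimage) (auto simp: smooth_map_def)
    qed
    have "(Ua \<times> U, map_prod ca c) \<in> prod_atlas A A" using ca c by (auto simp: prod_atlas_def)
    then have "smooth_on ?T (d \<circ> mu \<circ> inv_into (Ua \<times> U) (map_prod ca c))"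
      using smooth_mult d by (auto simp: smooth_map_def)
    from smooth_on_compose[OF S T _ this smooth_on_Pair_left[OF S, of "ca a"]]
    have "smooth_on ?S (\<lambda>y. (d \<circ> mu \<circ> inv_into (Ua \<times> U) (map_prod ca c)) (ca a, y))"
      using ca(2) by force
    then show ?thesis
      by (rule smooth_on_cong[OF S, rotated])
         (use inv_into_map_prod[OF ca(1) c ca(2)] chart_inj[OF c] in auto)
  qed
  then show ?thesis using continuous_lt by (auto simp: smooth_map_def)
qed

lemma lt_inverse: "inv_into UNIV (lt a) = lt (inv\<^bsub>G\<^esub> a)"
  by (rule Hilbert_Choice.inv_equality) (simp_all flip: m_assoc)

lemma diffeomorphism_lt: "diffeomorphism A A (lt a)"
proof -
  have "bij (lt a)"
    by (rule o_bij[of "lt (inv\<^bsub>G\<^esub> a)"]) (auto simp: fun_eq_iff simp flip: m_assoc)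
  then show ?thesis
    using smooth_map_lt[of a] smooth_map_lt[of "inv\<^bsub>G\<^esub> a"] by (simp add: diffeomorphism_def lt_inverse)
qed

lemma manifold_diffeo_lt: "manifold_diffeo A (lt a)"
  by unfold_locales (rule diffeomorphism_lt)

lemmas lt_differential_apply = manifold_diffeo.differential_apply[OF manifold_diffeo_lt]
lemmas lt_differential_tangent = manifold_diffeo.differential_tangent[OF manifold_diffeo_lt]

text \<open>In a chart at the unit, \<open>v\<close> is a fixed combination of partial derivatives.
  Applied to \<open>f \<circ> lt a\<close>, it becomes a combination of derivatives of the jointly
  smooth function \<open>(a, x) \<mapsto> f (a x)\<close> in the second variable, taken at the unit,
  and these are smooth in \<open>a\<close>. This is the smoothness of left-invariant fields.\<close>

lemma smooth_fun_on_tangent_lt: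
  assumes v: "v \<in> tangent_space A \<one>\<^bsub>G\<^esub>" and W: "open W" "smooth_fun_on A W f"
  shows "smooth_fun_on A W (\<lambda>a. v (f \<circ> lt a))"
proof (rule smooth_fun_onI)
  fix p assume p: "p \<in> W"
  obtain U c where c: "(U, c) \<in> A" "p \<in> U" by (rule chart_at)
  obtain U0 c0 where c0: "(U0, c0) \<in> A" "\<one>\<^bsub>G\<^esub> \<in> U0" by (rule chart_at)
  obtain \<alpha> where \<alpha>: "\<And>f. smooth_at A \<one>\<^bsub>G\<^esub> f \<Longrightarrow>
      v f = (\<Sum>b\<in>Basis. \<alpha> b * frechet_derivative (f \<circ> inv_into U0 c0) (at (c0 \<one>\<^bsub>G\<^esub>)) b)"
    using tangent_partial[OF v c0] by metis
  let ?S = "c ` (U \<inter> W)"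
  let ?T = "map_prod c c0 ` ((U \<times> U0) \<inter> mu -` W)"
  let ?e = "c0 \<one>\<^bsub>G\<^esub>"
  \<comment> \<open>The function \<open>(a, x) \<mapsto> f (a x)\<close> in the product chart;
    directions \<open>(0, b)\<close> differentiate it in \<open>x\<close> only.\<close>
  define H where "H = (f \<circ> mu) \<circ> inv_into (U \<times> U0) (map_prod c c0)"
  have S: "open ?S" using open_chart_image[OF c(1) W(1)] .
  have "open (mu -` W)"
    using smooth_mult W(1) by (intro open_vimage) (auto simp: smooth_map_def)
  then have T: "open ?T"
    by (rule map_prod_chart(2)[OF smooth_manifold_axioms smooth_manifold_axioms c(1) c0(1)])
  have "smooth_fun_on (prod_atlas A A) (mu -` W) (f \<circ> mu)"
    by (rule smooth_fun_on_compose[OF _ _ smooth_manifold_axioms smooth_mult W])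
       (auto simp: prod_atlas_def intro!: map_prod_chart smooth_manifold_axioms)
  moreover have "(U \<times> U0, map_prod c c0) \<in> prod_atlas A A" using c c0 by (auto simp: prod_atlas_def)
  ultimately have H: "smooth_on ?T H" by (auto simp: smooth_fun_on_def H_def)
  have in_T: "(y, ?e) \<in> ?T" if y: "y \<in> ?S" for y
  proof -
    obtain a where "y = c a" "a \<in> U" "a \<in> W" using y by blast
    then show ?thesis using c0(2) by (auto intro!: image_eqI[of _ _ "(a, \<one>\<^bsub>G\<^esub>)"])
  qed
  have v_eq: "v (f \<circ> lt (inv_into U c y)) = (\<Sum>b\<in>Basis. \<alpha> b * frechet_derivative H (at (y, ?e)) (0, b))"
    if y: "y \<in> ?S" for y
  proof -
    obtain a where a: "y = c a" "a \<in> U" "a \<in> W" using y by blast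
    have inv_a: "inv_into U c y = a" using a chart_inj[OF c(1)] by simp
    have "smooth_at A a f" using W a by (intro smooth_atI)
    then have sm: "smooth_at A \<one>\<^bsub>G\<^esub> (f \<circ> lt a)"
      using manifold_diffeo.smooth_at_diffeo[OF manifold_diffeo_lt, of "\<one>\<^bsub>G\<^esub>" f a] by simp
    have "((\<lambda>x. (y, x)) has_derivative (\<lambda>h. (0, h))) (at ?e)"
      by (intro has_derivative_Pair has_derivative_const has_derivative_ident)
    from has_derivative_compose[OF this smooth_on_has_derivative[OF H in_T[OF y]]]
    have D: "((\<lambda>x. H (y, x)) has_derivative (\<lambda>h. frechet_derivative H (at (y, ?e)) (0, h))) (at ?e)" .
    have "((f \<circ> lt a \<circ> inv_into U0 c0) has_derivative (\<lambda>h. frechet_derivative H (at (y, ?e)) (0, h))) (at ?e)"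
    proof (rule has_derivative_transform_within_open[OF D])
      show "open (c0 ` U0)" "?e \<in> c0 ` U0" using chart_open[OF c0(1)] c0(2) by auto
      fix x assume "x \<in> c0 ` U0"
      then obtain q where "x = c0 q" "q \<in> U0" by blast
      then show "H (y, x) = (f \<circ> lt a \<circ> inv_into U0 c0) x"
        using inv_into_map_prod[OF c(1) c0(1) a(2)] a(1) chart_inj[OF c0(1)] by (simp add: H_def)
    qed
    then have "frechet_derivative (f \<circ> lt a \<circ> inv_into U0 c0) (at ?e) =
        (\<lambda>h. frechet_derivative H (at (y, ?e)) (0, h))"
      by (rule frechet_derivative_at[symmetric])
    then show ?thesis using \<alpha>[OF sm] by (simp add: inv_a)
  qed
  have "smooth_on ?S (\<lambda>y. \<Sum>b\<in>Basis. \<alpha> b * frechet_derivative H (at (y, ?e)) (0, b))"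
  proof (rule smooth_on_sum[OF S])
    fix b
    show "smooth_on ?S (\<lambda>y. \<alpha> b * frechet_derivative H (at (y, ?e)) (0, b))"
      by (rule smooth_on_mult[OF S smooth_on_const[OF S]
          smooth_on_compose[OF S T _ smooth_on_frechet_derivative[OF H] smooth_on_Pair_right[OF S]]])
         (use in_T in blast)
  qed
  then have "smooth_on ?S ((\<lambda>a. v (f \<circ> lt a)) \<circ> inv_into U c)"
    by (rule smooth_on_cong[OF S, rotated]) (simp add: v_eq)
  then show "\<exists>U c W'. (U, c) \<in> A \<and> p \<in> U \<and> open W' \<and> p \<in> W' \<and>
      smooth_on (c ` (U \<inter> W')) ((\<lambda>a. v (f \<circ> lt a)) \<circ> inv_into U c)"
    using c p W(1) by blast
qed

section \<open>Left-invariant vector fields\<close>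

abbreviation \<nn> :: "('m \<Rightarrow> 'm tangent) set" where "\<nn> \<equiv> lie_algebra A G"

lemma lie_algebra_vector_field: "X \<in> \<nn> \<Longrightarrow> X \<in> vector_fields A"
  by (simp add: lie_algebra_def)

lemma lie_algebra_tangent: "X \<in> \<nn> \<Longrightarrow> X p \<in> tangent_space A p"
  by (simp add: lie_algebra_vector_field vector_field_tangent)

text \<open>Left translations act transitively: translation by \<open>q\<close> times the inverse of
  \<open>p\<close> carries \<open>p\<close> to \<open>q\<close>. Any point, not only the unit, can
  thus serve as base point, which is required at \<open>p\<close> and
  \<open>\<phi> p\<close>.\<close>

lemma lie_algebra_at:
  assumes "X \<in> \<nn>"
  shows "X q = differential A (lt (q \<otimes>\<^bsub>G\<^esub> inv\<^bsub>G\<^esub> p)) p (X p)"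
proof -
  have "X ((q \<otimes>\<^bsub>G\<^esub> inv\<^bsub>G\<^esub> p) \<otimes>\<^bsub>G\<^esub> p) = differential A (lt (q \<otimes>\<^bsub>G\<^esub> inv\<^bsub>G\<^esub> p)) p (X p)"
    using assms by (simp add: lie_algebra_def)
  moreover have "(q \<otimes>\<^bsub>G\<^esub> inv\<^bsub>G\<^esub> p) \<otimes>\<^bsub>G\<^esub> p = q" by (simp add: m_assoc)
  ultimately show ?thesis by simp
qed

lemma lie_algebra_eqI:
  assumes "X \<in> \<nn>" "Y \<in> \<nn>" "X p = Y p"
  shows "X = Y"
proof
  fix q
  show "X q = Y q"
    using lie_algebra_at[OF assms(1), of q p] lie_algebra_at[OF assms(2), of q p] assms(3)
    by metis
qed

lemma subspace_lie_algebra: "subspace \<nn>"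
  unfolding subspace_def
proof (intro conjI ballI allI)
  show "0 \<in> \<nn>"
    using vector_field_zero by (simp add: lie_algebra_def linear_0[OF linear_differential])
next
  fix X Y assume XY: "X \<in> \<nn>" "Y \<in> \<nn>"
  then have "X + Y \<in> vector_fields A" by (intro vector_field_add lie_algebra_vector_field)
  then show "X + Y \<in> \<nn>"
    using XY by (simp add: lie_algebra_def linear_add[OF linear_differential])
next
  fix X a assume X: "X \<in> \<nn>"
  then have "a *\<^sub>R X \<in> vector_fields A" by (intro vector_field_scaleR lie_algebra_vector_field)
  then show "a *\<^sub>R X \<in> \<nn>"
    using X by (simp add: lie_algebra_def scaleR_fun_apply[of a X] linear_scale[OF linear_differential])
qed

text \<open>Move \<open>v\<close> to the unit and spread it by left translations; with
  \<open>lie_algebra_eqI\<close> this identifies the Lie algebra with each tangent space.\<close>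

lemma lie_algebra_extend:
  assumes v: "v \<in> tangent_space A p"
  obtains X where "X \<in> \<nn>" "X p = v"
proof -
  define w where "w = differential A (lt (inv\<^bsub>G\<^esub> p)) p v"
  define X where "X a = differential A (lt a) \<one>\<^bsub>G\<^esub> w" for a
  have w: "w \<in> tangent_space A \<one>\<^bsub>G\<^esub>"
    using lt_differential_tangent[OF v, of "inv\<^bsub>G\<^esub> p"] by (simp add: w_def)
  have X_apply: "X a f = w (f \<circ> lt a)" for a f
    by (simp add: X_def lt_differential_apply[OF w])
  have X_tangent: "X a \<in> tangent_space A a" for a
    using lt_differential_tangent[OF w, of a] by (simp add: X_def)
  have "X \<in> vector_fields A"
    using X_tangent smooth_fun_on_tangent_lt[OF w] by (auto simp: vector_fields_def X_apply)
  moreover have "X (a \<otimes>\<^bsub>G\<^esub> p) = differential A (lt a) p (X p)" for a p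
    by (simp add: fun_eq_iff lt_differential_apply[OF X_tangent] X_apply o_def m_assoc)
  ultimately have "X \<in> \<nn>" by (simp add: lie_algebra_def)
  moreover have "X p = v"
    by (simp add: fun_eq_iff X_apply w_def lt_differential_apply[OF v] o_def flip: m_assoc)
  ultimately show ?thesis using that by blast
qed

text \<open>Evaluation at the unit embeds the Lie algebra in a finite-dimensional space, so a
  maximal independent set is finite.\<close>

lemma lie_algebra_basis:
  obtains B where "finite B" "independent B" "span B = \<nn>"
proof -
  obtain B where B: "B \<subseteq> \<nn>" "independent B" "\<nn> \<subseteq> span B"
    using real_vector.maximal_independent_subset by blast
  have span: "span B = \<nn>"
    using B span_minimal[OF B(1) subspace_lie_algebra] by blast
  let ?ev = "\<lambda>X::'m \<Rightarrow> 'm tangent. X \<one>\<^bsub>G\<^esub>"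
  have ev: "linear ?ev" by (rule linearI) (auto simp: scaleR_fun_apply)
  have inj: "inj_on ?ev (span B)"
    using lie_algebra_eqI by (auto simp: span inj_on_def)
  obtain C where C: "finite C" "tangent_space A \<one>\<^bsub>G\<^esub> \<subseteq> span C" by (rule tangent_space_finite_dim)
  have "?ev ` B \<subseteq> span C" using B(1) C(2) lie_algebra_tangent by blast
  moreover have "independent (?ev ` B)"
    by (rule linear_independent_injective_image[OF ev B(2) inj])
  ultimately have "finite (?ev ` B)"
    using real_vector.independent_span_bound[OF C(1)] by blast
  then have "finite B"
    by (rule finite_imageD) (rule inj_on_subset[OF inj real_vector.span_superset])
  then show ?thesis using that B(2) span by blast
qed

end

section \<open>Left-invariant metrics\<close>

locale metric_lie_group = lie_group A G + pseudo_riemannian_manifold A g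
  for A :: "('m::{t2_space, second_countable_topology}, 'e::euclidean_space) chart set"
    and G :: "'m monoid" and g :: "'m metric" +
  assumes lt_isometry: "u \<in> tangent_space A p \<Longrightarrow> w \<in> tangent_space A p \<Longrightarrow>
      g (a \<otimes>\<^bsub>G\<^esub> p) (differential A (lt a) p u) (differential A (lt a) p w) = g p u w"
begin

abbreviation form where "form \<equiv> induced_form G g"

text \<open>By left invariance the product of two left-invariant fields is constant, so it may be
  read off at any point.\<close>

lemma form_at:
  assumes "X \<in> \<nn>" "Y \<in> \<nn>"
  shows "form X Y = g p (X p) (Y p)"
  using lt_isometry[of "X \<one>\<^bsub>G\<^esub>" "\<one>\<^bsub>G\<^esub>" "Y \<one>\<^bsub>G\<^esub>" p] lie_algebra_tangent[OF assms(1)]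
    lie_algebra_tangent[OF assms(2)] lie_algebra_at[OF assms(1), of p "\<one>\<^bsub>G\<^esub>"]
    lie_algebra_at[OF assms(2), of p "\<one>\<^bsub>G\<^esub>"]
  by (simp add: induced_form_def)

lemma form_sym: "X \<in> \<nn> \<Longrightarrow> Y \<in> \<nn> \<Longrightarrow> form X Y = form Y X"
  by (simp add: induced_form_def metric_sym lie_algebra_tangent)

lemma form_add: "X \<in> \<nn> \<Longrightarrow> Y \<in> \<nn> \<Longrightarrow> Z \<in> \<nn> \<Longrightarrow> form (X + Y) Z = form X Z + form Y Z"
  by (simp add: induced_form_def metric_add_left lie_algebra_tangent)

lemma form_scale: "X \<in> \<nn> \<Longrightarrow> Y \<in> \<nn> \<Longrightarrow> form (a *\<^sub>R X) Y = a * form X Y"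
  by (simp add: induced_form_def scaleR_fun_apply[of a X] metric_scale_left lie_algebra_tangent)

lemma form_nondegenerate:
  assumes "X \<in> \<nn>" "Y \<in> \<nn>" "\<And>Z. Z \<in> \<nn> \<Longrightarrow> form X Z = form Y Z"
  shows "X = Y"
proof (rule lie_algebra_eqI[OF assms(1,2)])
  show "X \<one>\<^bsub>G\<^esub> = Y \<one>\<^bsub>G\<^esub>"
  proof (rule metric_nondegenerate)
    fix w assume "w \<in> tangent_space A \<one>\<^bsub>G\<^esub>"
    then obtain Z where "Z \<in> \<nn>" "Z \<one>\<^bsub>G\<^esub> = w" by (rule lie_algebra_extend)
    then show "g \<one>\<^bsub>G\<^esub> (X \<one>\<^bsub>G\<^esub>) w = g \<one>\<^bsub>G\<^esub> (Y \<one>\<^bsub>G\<^esub>) w"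
      using assms(3)[of Z] by (simp add: induced_form_def)
  qed (use assms lie_algebra_tangent in auto)
qed

lemma nondegenerate_form: "nondegenerate_on form \<nn>"
  unfolding nondegenerate_on_def
proof (intro ballI impI)
  fix X assume X: "X \<in> \<nn>" "\<forall>Y\<in>\<nn>. form X Y = 0"
  show "X = 0"
  proof (rule form_nondegenerate[OF X(1) subspace_0[OF subspace_lie_algebra]])
    fix Z assume "Z \<in> \<nn>"
    then show "form X Z = form 0 Z"
      using X form_scale[of X Z 0] by simp
  qed
qed

end

section \<open>Invariant frames, curvature and the Ricci operator\<close>

locale lie_group_frame = metric_lie_group A G g
  for A :: "('m::{t2_space, second_countable_topology}, 'e::euclidean_space) chart set"
    and G :: "'m monoid" and g :: "'m metric" +
  fixes B :: "('m \<Rightarrow> 'm tangent) set" and F :: "('m \<Rightarrow> 'm tangent) \<Rightarrow> 'm \<Rightarrow> 'm tangent"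
  assumes basis: "finite B" "independent B" "span B = lie_algebra A G"
    and dual: "b \<in> B \<Longrightarrow> F b \<in> lie_algebra A G"
    and dual_expand: "X \<in> lie_algebra A G \<Longrightarrow> X = (\<Sum>b\<in>B. induced_form G g X (F b) *\<^sub>R b)"
begin

lemma basis_lie_algebra: "b \<in> B \<Longrightarrow> b \<in> \<nn>"
  using basis(3) real_vector.span_base by auto

text \<open>Every tangent vector is a value of a left-invariant field, so the expansion in a basis
  of the Lie algebra evaluates to a frame expansion at each point.\<close>

sublocale framed_manifold A g B "\<lambda>b. b" F
proof
  fix v p assume "v \<in> tangent_space A p"
  then obtain X where X: "X \<in> \<nn>" "X p = v" by (rule lie_algebra_extend)
  have "X p = (\<Sum>b\<in>B. form X (F b) *\<^sub>R b) p" using dual_expand[OF X(1)] by simp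
  also have "\<dots> = (\<Sum>b\<in>B. (form X (F b) *\<^sub>R b) p)" by (rule sum_fun_apply)
  also have "\<dots> = (\<Sum>b\<in>B. g p v (F b p) *\<^sub>R b p)"
    by (rule sum.cong[OF refl], subst scaleR_fun_apply)
       (simp add: form_at[OF X(1) dual, of _ p] X(2))
  finally show "v = (\<Sum>b\<in>B. g p v (F b p) *\<^sub>R b p)" by (simp add: X(2))
qed (use basis dual basis_lie_algebra lie_algebra_vector_field in auto)

lemma manifold_isometryI: "\<phi> \<in> isometry_group A g \<Longrightarrow> manifold_isometry A g B (\<lambda>b. b) F \<phi>"
  by unfold_locales (auto simp: isometry_group_def)

lemma lt_isometry_group: "lt a \<in> isometry_group A g"
  using diffeomorphism_lt lt_isometry by (auto simp: isometry_group_def)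

text \<open>With left invariance phrased as being fixed by push-forward, any construction natural
  under isometries preserves it, since left translations are isometries. The curvature is the case
  at hand.\<close>

lemma lie_algebra_iff_push:
  "X \<in> \<nn> \<longleftrightarrow> X \<in> vector_fields A \<and> (\<forall>a. manifold_diffeo.push A (lt a) X = X)"
proof -
  have "(\<forall>p. X (a \<otimes>\<^bsub>G\<^esub> p) = differential A (lt a) p (X p)) \<longleftrightarrow> manifold_diffeo.push A (lt a) X = X" for a
  proof -
    interpret a: manifold_diffeo A "lt a" by (rule manifold_diffeo_lt)
    have "a.push X = X \<longleftrightarrow> (\<forall>p. a.push X (lt a p) = X (lt a p))"
      using a.inverse_simps(2) by (metis ext)
    then show ?thesis by (auto simp: a.push_at)
  qed
  then show ?thesis by (auto simp: lie_algebra_def)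
qed

lemma curvature_lie_algebra:
  assumes "X \<in> \<nn>" "Y \<in> \<nn>" "Z \<in> \<nn>"
  shows "curvature A g X Y Z \<in> \<nn>"
proof -
  have "manifold_diffeo.push A (lt a) (curvature A g X Y Z) = curvature A g X Y Z" for a
  proof -
    interpret a: manifold_isometry A g B "\<lambda>b. b" F "lt a"
      by (rule manifold_isometryI[OF lt_isometry_group])
    show ?thesis
      using assms a.curvature_push[of X Y Z] by (simp add: lie_algebra_iff_push)
  qed
  then show ?thesis
    using assms by (simp add: lie_algebra_iff_push curvature_vector_field)
qed

lemma
  assumes "X \<in> \<nn>" "Y \<in> \<nn>" "Z \<in> \<nn>"
  shows curvature_scale_left: "curvature A g (a *\<^sub>R X) Y Z = a *\<^sub>R curvature A g X Y Z"
    and curvature_scale_right: "curvature A g X Y (a *\<^sub>R Z) = a *\<^sub>R curvature A g X Y Z"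
  using curvature_fmult_left[of X Y Z "\<lambda>_. a"] curvature_fmult_right[of X Y Z "\<lambda>_. a"] assms
    lie_algebra_vector_field smooth_fun_on_const[OF open_UNIV, of a]
  by (simp_all add: scaleR_fun_def[where 'a='m])

lemma ricci_tensor_basis:
  assumes "u \<in> \<nn>" "w \<in> \<nn>"
  shows "ricci_tensor A G g u w = (\<Sum>b\<in>B. representation B (curvature A g b u w) b)"
  unfolding ricci_tensor_def
  by (rule trace_on_basis[OF basis])
     (use assms lie_algebra_vector_field in
       \<open>auto intro: curvature_lie_algebra curvature_add_left curvature_scale_left\<close>)

text \<open>Linearity in \<open>w\<close>, in the form that exhibits the vector representing the
  functional \<open>ricci_tensor A G g u\<close>.\<close>

lemma ricci_tensor_expand:
  assumes u: "u \<in> \<nn>" and w: "w \<in> \<nn>"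
  shows "ricci_tensor A G g u w = (\<Sum>b\<in>B. form w (F b) * ricci_tensor A G g u b)"
proof -
  have in_span: "curvature A g b u x \<in> span B" if "b \<in> B" "x \<in> \<nn>" for b x
    using curvature_lie_algebra[OF basis_lie_algebra u] that basis(3) by simp
  have "ricci_tensor A G g u w = ricci_tensor A G g u (\<Sum>b\<in>B. form w (F b) *\<^sub>R b)"
    using dual_expand[OF w] by simp
  also have "\<dots> = (\<Sum>b\<in>B. form w (F b) *\<^sub>R ricci_tensor A G g u b)"
  proof (rule linear_on_sum[OF subspace_lie_algebra])
    fix x y assume xy: "x \<in> \<nn>" "y \<in> \<nn>"
    have "representation B (curvature A g b u (x + y)) b =
        representation B (curvature A g b u x) b + representation B (curvature A g b u y) b" if "b \<in> B" for b
    proof -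
      have "curvature A g b u (x + y) = curvature A g b u x + curvature A g b u y"
        using that xy u by (intro curvature_add_right) (auto intro: lie_algebra_vector_field basis_lie_algebra)
      then show ?thesis
        using real_vector.representation_add[OF basis(2) in_span in_span, OF that xy(2) that xy(1)] by simp
    qed
    then show "ricci_tensor A G g u (x + y) = ricci_tensor A G g u x + ricci_tensor A G g u y"
      using xy by (simp add: ricci_tensor_basis[OF u] subspace_add[OF subspace_lie_algebra] sum.distrib)
  next
    fix a x assume x: "x \<in> \<nn>"
    have "representation B (curvature A g b u (a *\<^sub>R x)) b =
        a * representation B (curvature A g b u x) b" if "b \<in> B" for b
    proof -
      have "curvature A g b u (a *\<^sub>R x) = a *\<^sub>R curvature A g b u x"
        by (rule curvature_scale_right[OF basis_lie_algebra[OF that] u x])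
      then show ?thesis
        using real_vector.representation_scale[OF basis(2) in_span, OF that x] by simp
    qed
    then show "ricci_tensor A G g u (a *\<^sub>R x) = a *\<^sub>R ricci_tensor A G g u x"
      using x by (simp add: ricci_tensor_basis[OF u] subspace_scale[OF subspace_lie_algebra] sum_distrib_left)
  qed (rule basis_lie_algebra)
  finally show ?thesis by simp
qed

lemma ricci_operator:
  assumes u: "u \<in> \<nn>"
  shows "ricci_operator A G g u \<in> \<nn> \<and>
    (\<forall>w\<in>\<nn>. form (ricci_operator A G g u) w = ricci_tensor A G g u w)"
proof -
  \<comment> \<open>Its product with \<open>w\<close> is the sum of
    \<open>ricci_tensor A G g u b\<close> times the coefficient of \<open>w\<close> at
    \<open>b\<close>.\<close>
  let ?r = "\<Sum>b\<in>B. ricci_tensor A G g u b *\<^sub>R F b"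
  have "\<exists>!r. r \<in> \<nn> \<and> (\<forall>w\<in>\<nn>. form r w = ricci_tensor A G g u w)"
  proof (rule ex1I[of _ ?r])
    have "form ?r w = ricci_tensor A G g u w" if w: "w \<in> \<nn>" for w
    proof -
      have "form ?r w = (\<Sum>b\<in>B. ricci_tensor A G g u b *\<^sub>R form (F b) w)"
        by (rule linear_on_sum[OF subspace_lie_algebra, where h="\<lambda>x. form x w"])
           (use w dual in \<open>simp_all add: form_add form_scale\<close>)
      then show ?thesis
        using w dual ricci_tensor_expand[OF u w] by (simp add: form_sym mult.commute)
    qed
    then show "?r \<in> \<nn> \<and> (\<forall>w\<in>\<nn>. form ?r w = ricci_tensor A G g u w)"
      using dual subspace_lie_algebra by (auto intro!: subspace_sum subspace_scale)
    then show "r = ?r" if "r \<in> \<nn> \<and> (\<forall>w\<in>\<nn>. form r w = ricci_tensor A G g u w)" for r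
      using that by (intro form_nondegenerate) auto
  qed
  from theI'[OF this] show ?thesis unfolding ricci_operator_def .
qed

end

text \<open>Transporting the differential of an isometry at \<open>p\<close> to the Lie algebra by left translations
  gives a linear automorphism that intertwines the Ricci operator with itself.\<close>

locale lie_group_isometry = lie_group_frame A G g B F + manifold_isometry A g B "\<lambda>b. b" F \<phi>
  for A :: "('m::{t2_space, second_countable_topology}, 'e::euclidean_space) chart set"
    and G :: "'m monoid" and g :: "'m metric" and B F and \<phi> :: "'m \<Rightarrow> 'm" +
  fixes p :: 'm
begin

text \<open>Given by a formula for every \<open>X\<close>, so that \<open>linear T\<close> holds on
  the whole type; on the Lie algebra it yields the left-invariant field through the image vector at
  \<open>\<phi> p\<close>.\<close>

definition T :: "('m \<Rightarrow> 'm tangent) \<Rightarrow> 'm \<Rightarrow> 'm tangent"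
  where "T X = (\<lambda>q. differential A (lt (q \<otimes>\<^bsub>G\<^esub> inv\<^bsub>G\<^esub> \<phi> p)) (\<phi> p) (differential A \<phi> p (X p)))"

lemma linear_T: "linear T"
proof (rule linearI; rule ext)
  fix X Y q and a :: real
  show "T (X + Y) q = (T X + T Y) q"
    by (simp add: T_def linear_add[OF linear_differential])
  show "T (a *\<^sub>R X) q = (a *\<^sub>R T X) q"
    by (simp add: T_def linear_scale[OF linear_differential] scaleR_fun_apply[of a X]
        scaleR_fun_apply[where x=q])
qed

lemma T_lie_algebra:
  assumes X: "X \<in> \<nn>"
  shows "T X \<in> \<nn>" "T X (\<phi> p) = differential A \<phi> p (X p)"
proof -
  obtain Y where Y: "Y \<in> \<nn>" "Y (\<phi> p) = differential A \<phi> p (X p)"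
    using differential_tangent[OF lie_algebra_tangent[OF X]] by (rule lie_algebra_extend)
  have "T X = Y"
    using lie_algebra_at[OF Y(1), of _ "\<phi> p"] Y(2) by (simp add: T_def fun_eq_iff)
  then show "T X \<in> \<nn>" "T X (\<phi> p) = differential A \<phi> p (X p)" using Y by auto
qed

lemma T_push: "X \<in> \<nn> \<Longrightarrow> T X (\<phi> p) = push X (\<phi> p)"
  by (simp add: T_lie_algebra push_at)

lemma form_T: "X \<in> \<nn> \<Longrightarrow> Y \<in> \<nn> \<Longrightarrow> form (T X) (T Y) = form X Y"
  using form_at[of "T X" "T Y" "\<phi> p"] form_at[of X Y p]
  by (simp add: T_lie_algebra isometry lie_algebra_tangent)

lemma inj_T: "inj_on T \<nn>"
proof (rule inj_onI)
  fix X Y assume XY: "X \<in> \<nn>" "Y \<in> \<nn>" "T X = T Y"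
  then show "X = Y"
    using form_T by (intro form_nondegenerate) metis+
qed

text \<open>A field \<open>Z\<close> with \<open>push Z = Y\<close> need not be left-invariant; the
  left-invariant field with the same value at \<open>p\<close> is the preimage.\<close>

lemma image_T: "T ` \<nn> = \<nn>"
proof (intro equalityI subsetI)
  fix Y assume Y: "Y \<in> \<nn>"
  obtain Z where Z: "Z \<in> vector_fields A" "push Z = Y"
    using push_surj[OF lie_algebra_vector_field[OF Y]] by metis
  obtain X where X: "X \<in> \<nn>" "X p = Z p"
    using vector_field_tangent[OF Z(1)] by (rule lie_algebra_extend)
  have "T X (\<phi> p) = Y (\<phi> p)"
    using X Z(2) push_at[of Z p] by (simp add: T_lie_algebra)
  then have "T X = Y" by (rule lie_algebra_eqI[OF T_lie_algebra(1)[OF X(1)] Y])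
  then show "Y \<in> T ` \<nn>" using X by blast
qed (use T_lie_algebra in blast)

text \<open>At \<open>\<phi> p\<close> the fields \<open>T X\<close> and \<open>push X\<close>
  agree, so tensoriality and naturality give the equality there. Both sides are left-invariant, so
  one point suffices.\<close>

lemma curvature_T:
  assumes "X \<in> \<nn>" "Y \<in> \<nn>" "Z \<in> \<nn>"
  shows "curvature A g (T X) (T Y) (T Z) = T (curvature A g X Y Z)"
proof (rule lie_algebra_eqI)
  have "curvature A g (T X) (T Y) (T Z) (\<phi> p) = curvature A g (push X) (push Y) (push Z) (\<phi> p)"
    by (rule curvature_cong)
       (use assms in \<open>simp_all add: T_push T_lie_algebra lie_algebra_vector_field push_vector_field\<close>)
  also have "\<dots> = push (curvature A g X Y Z) (\<phi> p)"
    using assms by (simp add: curvature_push lie_algebra_vector_field)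
  also have "\<dots> = T (curvature A g X Y Z) (\<phi> p)"
    using assms by (simp add: T_push curvature_lie_algebra)
  finally show "curvature A g (T X) (T Y) (T Z) (\<phi> p) = T (curvature A g X Y Z) (\<phi> p)" .
qed (use assms in \<open>auto intro: curvature_lie_algebra T_lie_algebra\<close>)

text \<open>By \<open>curvature_T\<close>, the two endomorphisms whose traces are taken are
  conjugate under \<open>T\<close>.\<close>

lemma ricci_tensor_T:
  assumes u: "u \<in> \<nn>" and w: "w \<in> \<nn>"
  shows "ricci_tensor A G g (T u) (T w) = ricci_tensor A G g u w"
  unfolding ricci_tensor_def
proof (rule trace_on_conjugate[OF basis linear_T inj_T image_T])
  show "curvature A g (T x) (T u) (T w) = T (curvature A g x u w)" if "x \<in> \<nn>" for x
    by (rule curvature_T[OF that u w])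
qed (use u w in \<open>auto intro: curvature_lie_algebra curvature_add_left curvature_scale_left
      lie_algebra_vector_field T_lie_algebra\<close>)

lemma ricci_operator_T:
  assumes u: "u \<in> \<nn>"
  shows "ricci_operator A G g (T u) = T (ricci_operator A G g u)"
proof (rule form_nondegenerate)
  note r = ricci_operator[OF u] ricci_operator[OF T_lie_algebra(1)[OF u]]
  show "ricci_operator A G g (T u) \<in> \<nn>" "T (ricci_operator A G g u) \<in> \<nn>"
    using r T_lie_algebra by auto
  fix Z assume "Z \<in> \<nn>"
  then obtain w where w: "w \<in> \<nn>" "Z = T w" using image_T by blast
  then show "form (ricci_operator A G g (T u)) Z = form (T (ricci_operator A G g u)) Z"
    using r form_T[of "ricci_operator A G g u" w] ricci_tensor_T[OF u w(1)] T_lie_algebra by auto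
qed

lemma differential_distribution:
  assumes W: "W \<subseteq> \<nn>"
    and sum: "is_direct_sum (complexification W) I
      (\<lambda>i. associated_subspace \<nn> (ricci_operator A G g) (lam i))"
  shows "differential A \<phi> p ` left_invariant_distribution W p = left_invariant_distribution W (\<phi> p)"
proof -
  have TW: "T ` W = W"
    by (rule direct_sum_equivariant[OF subspace_lie_algebra linear_T inj_T image_T _ _ sum])
       (use ricci_operator ricci_operator_T in auto)
  have "differential A \<phi> p ` left_invariant_distribution W p = (\<lambda>X. T X (\<phi> p)) ` W"
    using W T_lie_algebra(2) by (force simp: left_invariant_distribution_def)
  also have "\<dots> = (\<lambda>X. X (\<phi> p)) ` T ` W" by (simp add: image_image)
  finally show ?thesis unfolding TW by (auto simp: left_invariant_distribution_def)
qed

end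

lemma metric_lie_group_frame:
  assumes "metric_lie_group A G g"
  obtains B F where "lie_group_frame A G g B F"
proof -
  interpret metric_lie_group A G g by fact
  obtain B where B: "finite B" "independent B" "span B = \<nn>" by (rule lie_algebra_basis)
  obtain F where F: "\<And>b. b \<in> B \<Longrightarrow> F b \<in> \<nn>" "\<And>X. X \<in> \<nn> \<Longrightarrow> X = (\<Sum>b\<in>B. form X (F b) *\<^sub>R b)"
    by (rule dual_basis_exists[OF B form_sym form_add form_scale nondegenerate_form]) auto
  have "lie_group_frame A G g B F"
    by unfold_locales (fact B F)+
  then show ?thesis by (rule that)
qed

theorem lemma4p3:
  fixes N :: "'m::{t2_space, second_countable_topology} monoid"
    and A :: "('m, 'e::euclidean_space) chart set"
    and g :: "'m metric"
    and lam :: "nat \<Rightarrow> complex"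
    and s j :: nat
  assumes "lie_group A N"
    and "simply_connected (UNIV :: 'm set)"
    and "two_step_nilpotent A N"
    and "left_invariant_metric A N g"
    and "nondegenerate_on (induced_form N g) (lie_center A N)"
    and "inj_on lam {1..s}"
    and "lam ` {1..s} = complex_eigenvalues (lie_algebra A N) (ricci_operator A N g)"
    and "j \<le> s"
    and "is_direct_sum (complexification (center_perp A N g)) {1..j}
           (\<lambda>i. associated_subspace (lie_algebra A N) (ricci_operator A N g) (lam i))"
    and "is_direct_sum (complexification (lie_center A N)) {j+1..s}
           (\<lambda>i. associated_subspace (lie_algebra A N) (ricci_operator A N g) (lam i))"
  shows "isometry_group A g = isometry_group_spl A N g"
proof -
  interpret lie_group A N by fact
  have "metric_lie_group A N g"
    using assms(4) by unfold_locales (auto simp: left_invariant_metric_def)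
  then obtain B F where "lie_group_frame A N g B F" by (rule metric_lie_group_frame)
  then interpret lie_group_frame A N g B F .
  \<comment> \<open>Stated for a general \<open>W\<close> and index set, to be used with
    \<open>{1..j}\<close> for \<open>center_perp\<close> and with \<open>{j+1..s}\<close> for
    \<open>lie_center\<close>.\<close>
  have "preserves_distribution A \<phi> (left_invariant_distribution W)"
    if \<phi>: "\<phi> \<in> isometry_group A g" and W: "W \<subseteq> lie_algebra A N"
      "is_direct_sum (complexification W) I
        (\<lambda>i. associated_subspace (lie_algebra A N) (ricci_operator A N g) (lam i))"
    for \<phi> W and I :: "nat set"
    unfolding preserves_distribution_def
  proof
    fix p
    interpret manifold_isometry A g B "\<lambda>b. b" F \<phi> by (rule manifold_isometryI[OF \<phi>])
    interpret lie_group_isometry A N g B F \<phi> p by unfold_locales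
    show "differential A \<phi> p ` left_invariant_distribution W p = left_invariant_distribution W (\<phi> p)"
      by (rule differential_distribution[OF W])
  qed
  moreover have "center_perp A N g \<subseteq> lie_algebra A N" "lie_center A N \<subseteq> lie_algebra A N"
    by (auto simp: center_perp_def lie_center_def)
  ultimately show ?thesis
    using assms(9,10) by (auto simp: isometry_group_spl_def)
qed

end
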